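(* For all integers $n,q\ge1$ with $q$ even and any $\beta_1,\beta_2\ge0$, $$F_{n,q}^{\mathrm{SYK}}\left(\sqrt{\beta_1^2+\beta_2^2}\right)\le F_{n,q}^{\mathrm{SYK}}(\beta_1)+F_{n,q}^{\mathrm{SYK}}(\beta_2).$$
   Context: Let $\mathcal{C}_n$ be the involutive associative unital $\mathbb{C}$-algebra generated by $\chi_1,\dots,\chi_n$ with relations $\chi_i^*=\chi_i$ and $\chi_i^2=1$ for $1\le i\le n$, and $\chi_i\chi_j+\chi_j\chi_i=0$ for $1\le i<j\le n$. It has dimension $2^n$, with basis the products $\chi_S=\chi_{s_1}\cdots\chi_{s_k}$ over subsets $S=\{s_1<\dots<s_k\}\subseteq\{1,\dots,n\}$ (with $\chi_\emptyset=1$). For $x\in\mathcal{C}_n$, let $M^x:\mathcal{C}_n\to\mathcal{C}_n$ be the linear operator of left multiplication by $x$. For a positive even integer $q$, the SYK Hamiltonian is $M^x$ for the random element $$x=i^{q/2}\sum_{1\le i_1<\dots<i_q\le n}J_{i_1,\dots,i_q}\,\chi_{i_1}\cdots\chi_{i_q},$$ where the prefactor $i$ is the imaginary unit and the $J_{i_1,\dots,i_q}$ are i.i.d. centered real Gaussians (with some fixed common variance). The operator $M^x$ is Hermitian (for the inner product making $(\chi_S)_S$ orthonormal). For $\beta\ge0$, the free energy is $F_{n,q}^{\mathrm{SYK}}(\beta)=\mathbb{E}\log\left(\mathrm{Tr}(e^{\beta M^x})/2^n\right)$. *)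

theory Defs
  imports "HOL-Probability.Probability"
begin

section \<open>The Clifford algebra\<close>

text \<open>
  The generators are indexed by a finite linearly ordered type \<open>'n\<close>, so that \<open>n = CARD('n)\<close> and
  \<open>'n\<close> plays the role of \<open>{1, \<dots>, n}\<close>. The algebra is constructed on its standard basis
  \<open>\<chi>\<^sub>S\<close>, \<open>S \<subseteq> {1, \<dots>, n}\<close>: an element is its family of coordinates. The presentation by generators
  and relations is recovered below (\<open>chi_square\<close>, \<open>chi_anticommute\<close>, \<open>star_chi\<close>,
  \<open>chi_prod_span\<close>, \<open>dim_clifford\<close>): the relations hold, and as they allow at most the \<open>2\<^sup>n\<close>
  sorted words, dimension \<open>2\<^sup>n\<close> means that no further relations hold.
\<close>

typedef 'n clifford = "UNIV :: ('n set \<Rightarrow> complex) set"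
  morphisms coeff of_coeff by simp

lemma coeff_of_coeff [simp]: "coeff (of_coeff f) = f"
  by (simp add: of_coeff_inverse)

lemma clifford_eqI: "(\<And>S. coeff x S = coeff y S) \<Longrightarrow> x = y"
  by (metis coeff_inject ext)

text \<open>
  The sign acquired when the word \<open>\<chi>\<^sub>S \<chi>\<^sub>T\<close> is sorted: one factor \<open>-1\<close> for each pair
  \<open>(s, t) \<in> S \<times> T\<close> with \<open>t < s\<close>. Equal generators end up adjacent and cancel because
  \<open>\<chi>\<^sub>i\<^sup>2 = 1\<close>, so \<open>\<chi>\<^sub>S \<chi>\<^sub>T = reorder_sign S T \<cdot> \<chi>\<^sub>U\<close> with \<open>U\<close> the symmetric difference of \<open>S\<close> and \<open>T\<close>.
\<close>

definition reorder_sign :: "'n::linorder set \<Rightarrow> 'n set \<Rightarrow> complex" where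
  "reorder_sign S T = (\<Prod>s\<in>S. \<Prod>t\<in>T. if t < s then -1 else 1)"

lemma prod_sym_diff:
  fixes f :: "'a \<Rightarrow> complex"
  assumes "finite A" "finite B" "\<And>s. f s * f s = 1"
  shows "prod f (sym_diff A B) = prod f A * prod f B"
proof -
  have A: "prod f A = prod f (A - B) * prod f (A \<inter> B)"
    using prod.Int_Diff[OF assms(1), of f B] by (simp add: mult.commute)
  have B: "prod f B = prod f (B - A) * prod f (A \<inter> B)"
    using prod.Int_Diff[OF assms(2), of f A] by (simp add: mult.commute Int_commute)
  have "prod f (A \<inter> B) * prod f (A \<inter> B) = 1"
    using assms by (simp flip: prod.distrib)
  moreover have "prod f (sym_diff A B) = prod f (A - B) * prod f (B - A)"
    using assms by (subst prod.union_disjoint) auto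
  ultimately show ?thesis unfolding A B by (simp add: algebra_simps)
qed

lemma reorder_sign_square: "reorder_sign S T * reorder_sign S T = 1"
  unfolding reorder_sign_def prod.distrib[symmetric] by (intro prod.neutral ballI) auto

lemma reorder_sign_left:
  fixes A B :: "'n::{finite,linorder} set"
  shows "reorder_sign (sym_diff A B) T = reorder_sign A T * reorder_sign B T"
  unfolding reorder_sign_def
  by (rule prod_sym_diff) (auto simp flip: prod.distrib intro!: prod.neutral)

lemma reorder_sign_right:
  fixes A B :: "'n::{finite,linorder} set"
  shows "reorder_sign S (sym_diff A B) = reorder_sign S A * reorder_sign S B"
  unfolding reorder_sign_def prod.distrib[symmetric]
  by (rule prod.cong[OF refl], rule prod_sym_diff) auto

lemma reorder_sign_empty [simp]: "reorder_sign {} T = 1" "reorder_sign S {} = 1"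
  by (simp_all add: reorder_sign_def)

lemma norm_reorder_sign [simp]: "norm (reorder_sign S T) = 1"
proof -
  have "norm (reorder_sign S T) * norm (reorder_sign S T) = 1"
    using reorder_sign_square[of S T] by (metis norm_mult norm_one)
  thus ?thesis by (metis abs_1 abs_norm_cancel abs_square_eq_1 power2_eq_square)
qed

lemma bij_sym_diff: "bij (\<lambda>U. sym_diff S U)"
  by (rule o_bij[where g = "\<lambda>U. sym_diff S U"]) (auto simp: fun_eq_iff)

lemma sum_sym_diff:
  fixes f :: "'n::finite set \<Rightarrow> 'a::comm_monoid_add"
  shows "(\<Sum>U\<in>UNIV. f (sym_diff S U)) = sum f UNIV"
  using sum.reindex_bij_betw[OF bij_sym_diff] .

definition cscale :: "complex \<Rightarrow> 'n clifford \<Rightarrow> 'n clifford" where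
  "cscale c x = of_coeff (\<lambda>S. c * coeff x S)"

lemma coeff_cscale [simp]: "coeff (cscale c x) S = c * coeff x S"
  by (simp add: cscale_def)

instantiation clifford :: (type) real_vector
begin

definition "0 = of_coeff (\<lambda>_. 0)"
definition "x + y = of_coeff (\<lambda>S. coeff x S + coeff y S)"
definition "x - y = of_coeff (\<lambda>S. coeff x S - coeff y S)"
definition "- x = of_coeff (\<lambda>S. - coeff x S)"
definition "scaleR r x = cscale (of_real r) x"

instance
  by standard
    (auto intro!: clifford_eqI simp: zero_clifford_def plus_clifford_def minus_clifford_def
      uminus_clifford_def scaleR_clifford_def algebra_simps)

end

lemma coeff_simps [simp]:
  "coeff 0 S = 0"
  "coeff (x + y) S = coeff x S + coeff y S"
  "coeff (x - y) S = coeff x S - coeff y S"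
  "coeff (- x) S = - coeff x S"
  "coeff (r *\<^sub>R x) S = of_real r * coeff x S"
  by (simp_all add: zero_clifford_def plus_clifford_def minus_clifford_def
      uminus_clifford_def scaleR_clifford_def)

lemma coeff_sum [simp]: "coeff (sum f A) S = (\<Sum>i\<in>A. coeff (f i) S)"
  by (induction A rule: infinite_finite_induct) auto

global_interpretation clifford: vector_space cscale
  by standard (auto intro!: clifford_eqI simp: algebra_simps)

text \<open>
  The coefficient of \<open>\<chi>\<^sub>U\<close> in \<open>x y\<close> collects the pairs \<open>S, T\<close> with symmetric difference \<open>U\<close>,
  that is \<open>T = sym_diff S U\<close>.
\<close>

instantiation clifford :: ("{finite,linorder}") real_algebra_1
begin

definition "1 = of_coeff (\<lambda>S. if S = {} then 1 else 0)"

definition "x * y = of_coeff (\<lambda>U. \<Sum>S\<in>UNIV.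
  reorder_sign S (sym_diff S U) * coeff x S * coeff y (sym_diff S U))"

instance
proof
  fix x y z :: "'a clifford" and r :: real
  show "x * y * z = x * (y * z)"
  proof (rule clifford_eqI)
    fix U
    let ?\<epsilon> = "reorder_sign :: 'a set \<Rightarrow> _"
    have "coeff (x * (y * z)) U = (\<Sum>S\<in>UNIV. \<Sum>T\<in>UNIV. ?\<epsilon> S (sym_diff S U) * coeff x S *
        (?\<epsilon> T (sym_diff T (sym_diff S U)) * coeff y T * coeff z (sym_diff T (sym_diff S U))))"
      by (simp add: times_clifford_def sum_distrib_left)
    also have "\<dots> = (\<Sum>S\<in>UNIV. \<Sum>V\<in>UNIV. ?\<epsilon> S (sym_diff S U) * coeff x S *
        (?\<epsilon> (sym_diff S V) (sym_diff (sym_diff S V) (sym_diff S U)) * coeff y (sym_diff S V) *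
         coeff z (sym_diff (sym_diff S V) (sym_diff S U))))"
      by (rule sum.cong[OF refl], subst sum_sym_diff[symmetric]) rule
    also have "\<dots> = (\<Sum>S\<in>UNIV. \<Sum>V\<in>UNIV. ?\<epsilon> V (sym_diff V U) *
        (?\<epsilon> S (sym_diff S V) * coeff x S * coeff y (sym_diff S V)) * coeff z (sym_diff V U))"
    proof (intro sum.cong refl)
      fix S V :: "'a set"
      have 1: "sym_diff (sym_diff S V) (sym_diff S U) = sym_diff V U"
        and 2: "sym_diff S U = sym_diff (sym_diff S V) (sym_diff V U)"
        and 3: "V = sym_diff S (sym_diff S V)" by auto
      have "?\<epsilon> S (sym_diff S U) * ?\<epsilon> (sym_diff S V) (sym_diff V U) =
          ?\<epsilon> S (sym_diff S V) * (?\<epsilon> S (sym_diff V U) * ?\<epsilon> (sym_diff S V) (sym_diff V U))"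
        by (subst 2, subst reorder_sign_right) (simp only: mult.assoc)
      also have "?\<epsilon> S (sym_diff V U) * ?\<epsilon> (sym_diff S V) (sym_diff V U) = ?\<epsilon> V (sym_diff V U)"
        by (subst reorder_sign_left[symmetric], subst 3[symmetric]) rule
      finally have e: "?\<epsilon> S (sym_diff S U) * ?\<epsilon> (sym_diff S V) (sym_diff V U) =
          ?\<epsilon> S (sym_diff S V) * ?\<epsilon> V (sym_diff V U)" .
      show "?\<epsilon> S (sym_diff S U) * coeff x S *
        (?\<epsilon> (sym_diff S V) (sym_diff (sym_diff S V) (sym_diff S U)) * coeff y (sym_diff S V) *
         coeff z (sym_diff (sym_diff S V) (sym_diff S U))) =
        ?\<epsilon> V (sym_diff V U) * (?\<epsilon> S (sym_diff S V) * coeff x S * coeff y (sym_diff S V)) *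
          coeff z (sym_diff V U)"
        unfolding 1 using arg_cong[OF e, of "\<lambda>w. w * (coeff x S * coeff y (sym_diff S V) *
          coeff z (sym_diff V U))"] by (simp only: mult_ac)
    qed
    also have "\<dots> = coeff (x * y * z) U"
      by (subst sum.swap) (simp add: times_clifford_def sum_distrib_left sum_distrib_right)
    finally show "coeff (x * y * z) U = coeff (x * (y * z)) U" ..
  qed
  show "1 * x = x"
  proof (rule clifford_eqI)
    fix U
    have "coeff (1 * x) U = (\<Sum>S\<in>(UNIV :: 'a set set). if S = {} then coeff x U else 0)"
      unfolding times_clifford_def one_clifford_def coeff_of_coeff
      by (rule sum.cong) auto
    thus "coeff (1 * x) U = coeff x U" by simp
  qed
  show "x * 1 = x"
  proof (rule clifford_eqI)
    fix U
    have "sym_diff S U = {} \<longleftrightarrow> S = U" for S :: "'a set" by auto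
    hence "coeff (x * 1) U = (\<Sum>S\<in>UNIV. if S = U then coeff x U else 0)"
      unfolding times_clifford_def one_clifford_def coeff_of_coeff
      by (intro sum.cong) auto
    thus "coeff (x * 1) U = coeff x U" by simp
  qed
  show "(0::'a clifford) \<noteq> 1"
  proof
    assume "(0::'a clifford) = 1"
    hence "coeff (0::'a clifford) {} = coeff 1 {}" by simp
    thus False unfolding one_clifford_def by simp
  qed
qed (auto intro!: clifford_eqI sum.cong
      simp: times_clifford_def sum.distrib[symmetric] sum_distrib_left algebra_simps)

end

lemma coeff_times:
  "coeff (x * y) U = (\<Sum>S\<in>UNIV. reorder_sign S (sym_diff S U) * coeff x S * coeff y (sym_diff S U))"
  by (simp add: times_clifford_def)

lemma coeff_one: "coeff 1 S = (if S = {} then 1 else 0)"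
  by (simp add: one_clifford_def)

lemma cscale_times_left: "cscale c x * y = cscale c (x * y)"
  by (rule clifford_eqI) (simp add: coeff_times sum_distrib_left algebra_simps)

lemma cscale_times_right: "x * cscale c y = cscale c (x * y)"
  by (rule clifford_eqI) (simp add: coeff_times sum_distrib_left algebra_simps)

lemma scaleR_cscale: "r *\<^sub>R x = cscale (of_real r) x"
  by (rule clifford_eqI) simp

definition chi :: "'n \<Rightarrow> 'n clifford" where
  "chi i = of_coeff (\<lambda>S. if S = {i} then 1 else 0)"

definition chi_prod :: "'n::{finite,linorder} set \<Rightarrow> 'n clifford" where
  "chi_prod S = prod_list (map chi (sorted_list_of_set S))"

text \<open>
  The involution is conjugate linear with
  \<open>\<chi>\<^sub>S\<^sup>* = \<chi>\<^sub>s\<^sub>k \<cdots> \<chi>\<^sub>s\<^sub>1 = (-1)\<^bsup>k(k-1)/2\<^esup> \<chi>\<^sub>S = reorder_sign S S \<cdot> \<chi>\<^sub>S\<close>.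
\<close>

definition star :: "'n::linorder clifford \<Rightarrow> 'n clifford" where
  "star x = of_coeff (\<lambda>S. reorder_sign S S * cnj (coeff x S))"

lemma basis_times:
  fixes S T :: "'n::{finite,linorder} set"
  shows "of_coeff (\<lambda>U. if U = S then 1 else 0) * of_coeff (\<lambda>U. if U = T then 1 else 0) =
    cscale (reorder_sign S T) (of_coeff (\<lambda>U. if U = sym_diff S T then 1 else 0))"
proof (rule clifford_eqI)
  fix U
  have *: "sym_diff S U = T \<longleftrightarrow> U = sym_diff S T" by auto
  have "coeff (of_coeff (\<lambda>U. if U = S then 1 else 0) * of_coeff (\<lambda>U. if U = T then 1 else 0)) U
    = (\<Sum>A\<in>UNIV. if A = S then (if sym_diff S U = T then reorder_sign S T else 0) else 0)"
    unfolding coeff_times by (rule sum.cong) auto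
  thus "coeff (of_coeff (\<lambda>U. if U = S then 1 else 0) * of_coeff (\<lambda>U. if U = T then 1 else 0)) U
    = coeff (cscale (reorder_sign S T) (of_coeff (\<lambda>U. if U = sym_diff S T then 1 else 0))) U"
    using * by simp
qed

lemma chi_square: "chi i * chi i = 1" for i :: "'n::{finite,linorder}"
  unfolding chi_def basis_times
  by (rule clifford_eqI) (simp add: coeff_one reorder_sign_def)

lemma chi_anticommute: "i \<noteq> j \<Longrightarrow> chi i * chi j + chi j * chi i = 0"
  for i j :: "'n::{finite,linorder}"
  unfolding chi_def basis_times
  by (rule clifford_eqI) (auto simp: reorder_sign_def Un_commute)

lemma coeff_chi_prod:
  "coeff (chi_prod S) T = (if T = S then 1 else 0)" for S :: "'n::{finite,linorder} set"
proof -
  have "sorted_wrt (<) xs \<Longrightarrow>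
      prod_list (map chi xs) = of_coeff (\<lambda>T. if T = set xs then 1 else 0)" for xs :: "'n list"
  proof (induction xs)
    case Nil
    show ?case by (rule clifford_eqI) (simp add: coeff_one)
  next
    case (Cons a xs)
    have d: "a \<notin> set xs" using Cons.prems by auto
    have "sym_diff {a} (set xs) = set (a # xs)" using d by auto
    moreover have "reorder_sign {a} (set xs) = 1"
      using Cons.prems by (auto simp: reorder_sign_def intro!: prod.neutral)
    ultimately show ?case
      using Cons basis_times[of "{a}" "set xs"] by (simp add: chi_def)
  qed
  from this[of "sorted_list_of_set S"] show ?thesis
    by (simp add: chi_prod_def)
qed

lemma chi_prod_expansion: "x = (\<Sum>S\<in>UNIV. cscale (coeff x S) (chi_prod S))"
  for x :: "'n::{finite,linorder} clifford"
  by (rule clifford_eqI) (simp add: coeff_chi_prod if_distrib cong: if_cong)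

lemma chi_prod_times: "chi_prod S * chi_prod T = cscale (reorder_sign S T) (chi_prod (sym_diff S T))"
  for S T :: "'n::{finite,linorder} set"
proof -
  have "chi_prod S = of_coeff (\<lambda>U. if U = S then 1 else 0)" for S :: "'n set"
    by (rule clifford_eqI) (simp add: coeff_chi_prod)
  thus ?thesis by (simp add: basis_times)
qed

lemma inj_chi_prod: "inj (chi_prod :: 'n::{finite,linorder} set \<Rightarrow> _)"
proof (rule injI)
  fix S T :: "'n set"
  assume "chi_prod S = chi_prod T"
  hence "coeff (chi_prod S) S = coeff (chi_prod T) S" by simp
  thus "S = T" by (simp add: coeff_chi_prod split: if_splits)
qed

lemma chi_prod_span: "clifford.span (range (chi_prod :: 'n::{finite,linorder} set \<Rightarrow> _)) = UNIV"
proof -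
  have "x \<in> clifford.span (range chi_prod)" for x :: "'n clifford"
    by (subst chi_prod_expansion)
      (intro clifford.span_sum clifford.span_scale clifford.span_base rangeI)
  thus ?thesis by auto
qed

lemma chi_prod_independent:
  "clifford.independent (range (chi_prod :: 'n::{finite,linorder} set \<Rightarrow> _))"
proof (rule clifford.independent_if_scalars_zero)
  show "finite (range (chi_prod :: 'n set \<Rightarrow> _))" by simp
next
  fix f :: "'n clifford \<Rightarrow> complex" and x
  assume s: "(\<Sum>x\<in>range (chi_prod :: 'n set \<Rightarrow> _). cscale (f x) x) = 0" and "x \<in> range (chi_prod :: 'n set \<Rightarrow> _)"
  then obtain S :: "'n set" where x: "x = chi_prod S" by auto
  have "(\<Sum>T\<in>(UNIV :: 'n set set). cscale (f (chi_prod T)) (chi_prod T)) = 0"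
    using s by (subst (asm) sum.reindex[OF inj_chi_prod]) (simp add: o_def)
  hence "coeff (\<Sum>T\<in>UNIV. cscale (f (chi_prod T)) (chi_prod T)) S = 0" by simp
  thus "f x = 0" by (simp add: x coeff_chi_prod if_distrib cong: if_cong)
qed

lemma dim_clifford: "clifford.dim (UNIV :: 'n::{finite,linorder} clifford set) = 2 ^ CARD('n)"
proof -
  have "clifford.dim (UNIV :: 'n clifford set) = card (range (chi_prod :: 'n set \<Rightarrow> _))"
    by (rule clifford.dim_eq_card) (simp_all add: chi_prod_span chi_prod_independent)
  also have "\<dots> = CARD('n set)" by (rule card_image[OF inj_chi_prod])
  finally show ?thesis by (simp add: card_UNIV_set)
qed

lemma star_chi: "star (chi i) = chi i"
  by (rule clifford_eqI) (simp add: star_def chi_def reorder_sign_def)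

lemma cnj_reorder_sign [simp]: "cnj (reorder_sign S T) = reorder_sign S T"
  by (simp add: reorder_sign_def if_distrib cong: if_cong)

lemma star_star: "star (star x) = x"
  by (rule clifford_eqI) (simp add: star_def reorder_sign_square flip: mult.assoc)

lemma star_plus: "star (x + y) = star x + star y"
  by (rule clifford_eqI) (simp add: star_def algebra_simps)

lemma star_cscale: "star (cscale c x) = cscale (cnj c) (star x)"
  by (rule clifford_eqI) (simp add: star_def)

lemma star_times: "star (x * y) = star y * star x" for x y :: "'n::{finite,linorder} clifford"
proof (rule clifford_eqI)
  fix U
  let ?\<epsilon> = "reorder_sign :: 'n set \<Rightarrow> _"
  have "coeff (star (x * y)) U =
      (\<Sum>S\<in>UNIV. ?\<epsilon> U U * (?\<epsilon> S (sym_diff S U) * cnj (coeff x S) * cnj (coeff y (sym_diff S U))))"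
    by (simp add: star_def coeff_times sum_distrib_left)
  also have "\<dots> = (\<Sum>T\<in>UNIV. ?\<epsilon> U U * (?\<epsilon> (sym_diff U T) (sym_diff (sym_diff U T) U) *
      cnj (coeff x (sym_diff U T)) * cnj (coeff y (sym_diff (sym_diff U T) U))))"
    by (subst sum_sym_diff[symmetric, of _ U]) rule
  also have "\<dots> = (\<Sum>T\<in>UNIV. ?\<epsilon> T (sym_diff T U) * (?\<epsilon> T T * cnj (coeff y T)) *
      (?\<epsilon> (sym_diff T U) (sym_diff T U) * cnj (coeff x (sym_diff T U))))"
  proof (intro sum.cong refl)
    fix T :: "'n set"
    define S where "S = sym_diff T U"
    have 1: "sym_diff (sym_diff U T) U = T" and 2: "sym_diff U T = S" and 3: "U = sym_diff S T"
      by (auto simp: S_def)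
    have e: "?\<epsilon> U U * ?\<epsilon> S T = ?\<epsilon> T S * ?\<epsilon> T T * ?\<epsilon> S S"
    proof -
      have "?\<epsilon> U U = ?\<epsilon> S S * ?\<epsilon> S T * (?\<epsilon> T S * ?\<epsilon> T T)"
        unfolding 3 by (simp only: reorder_sign_left reorder_sign_right mult_ac)
      hence "?\<epsilon> U U * ?\<epsilon> S T = (?\<epsilon> S T * ?\<epsilon> S T) * (?\<epsilon> T S * ?\<epsilon> T T * ?\<epsilon> S S)"
        by (simp only: mult_ac)
      thus ?thesis by (simp only: reorder_sign_square mult_1_left)
    qed
    show "?\<epsilon> U U * (?\<epsilon> (sym_diff U T) (sym_diff (sym_diff U T) U) *
      cnj (coeff x (sym_diff U T)) * cnj (coeff y (sym_diff (sym_diff U T) U))) =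
      ?\<epsilon> T (sym_diff T U) * (?\<epsilon> T T * cnj (coeff y T)) *
      (?\<epsilon> (sym_diff T U) (sym_diff T U) * cnj (coeff x (sym_diff T U)))"
      unfolding 1 unfolding 2 S_def[symmetric]
      using arg_cong[OF e, of "\<lambda>w. w * (cnj (coeff x S) * cnj (coeff y T))"]
      by (simp only: mult_ac)
  qed
  also have "\<dots> = coeff (star y * star x) U"
    by (simp add: star_def coeff_times)
  finally show "coeff (star (x * y)) U = coeff (star y * star x) U" .
qed

text \<open>
  A norm is needed only for the convergence of exponential series, and all norms on this
  finite-dimensional space are equivalent. The \<open>\<ell>\<^sup>1\<close> norm of the coordinates makes the algebra a
  Banach algebra, so the library's exponential is available for its elements as well.
\<close>

instantiation clifford :: (finite) real_normed_vector
begin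

definition norm_clifford :: "'a clifford \<Rightarrow> real" where
  "norm_clifford x = (\<Sum>S\<in>UNIV. norm (coeff x S))"
definition sgn_clifford :: "'a clifford \<Rightarrow> 'a clifford" where
  "sgn_clifford x = x /\<^sub>R norm x"
definition dist_clifford :: "'a clifford \<Rightarrow> 'a clifford \<Rightarrow> real" where
  "dist_clifford x y = norm (x - y)"
definition uniformity_clifford :: "('a clifford \<times> 'a clifford) filter" where
  "uniformity_clifford = (INF e\<in>{0<..}. principal {(x, y). dist x y < e})"
definition open_clifford :: "'a clifford set \<Rightarrow> bool" where
  "open_clifford U \<longleftrightarrow> (\<forall>x\<in>U. eventually (\<lambda>(x', y). x' = x \<longrightarrow> y \<in> U) uniformity)"

instance
proof
  fix x y :: "'a clifford" and r :: real
  show "norm x = 0 \<longleftrightarrow> x = 0"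
    by (auto simp: norm_clifford_def sum_nonneg_eq_0_iff intro!: clifford_eqI)
  show "norm (x + y) \<le> norm x + norm y"
    by (auto simp: norm_clifford_def norm_triangle_ineq simp flip: sum.distrib intro!: sum_mono)
  show "norm (r *\<^sub>R x) = \<bar>r\<bar> * norm x"
    by (simp add: norm_clifford_def norm_mult sum_distrib_left)
qed (simp_all add: sgn_clifford_def dist_clifford_def uniformity_clifford_def open_clifford_def)

end

instance clifford :: ("{finite,linorder}") real_normed_algebra_1
proof
  fix x y :: "'a clifford"
  have "norm (x * y) \<le> (\<Sum>U\<in>UNIV. \<Sum>S\<in>UNIV. norm (coeff x S) * norm (coeff y (sym_diff S U)))"
    unfolding norm_clifford_def coeff_times
    by (intro sum_mono order.trans[OF norm_sum]) (simp add: norm_mult)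
  also have "\<dots> = (\<Sum>S\<in>UNIV. norm (coeff x S) * (\<Sum>U\<in>UNIV. norm (coeff y (sym_diff S U))))"
    by (subst sum.swap) (simp add: sum_distrib_left)
  also have "\<dots> = norm x * norm y"
    by (subst sum_sym_diff) (simp add: norm_clifford_def sum_distrib_right)
  finally show "norm (x * y) \<le> norm x * norm y" .
  show "norm (1 :: 'a clifford) = 1"
    by (simp add: norm_clifford_def coeff_one if_distrib cong: if_cong)
qed

lemma norm_coeff_le: "norm (coeff x S) \<le> norm x" for x :: "'n::finite clifford"
  unfolding norm_clifford_def by (rule member_le_sum) auto

instance clifford :: (finite) banach
proof
  fix X :: "nat \<Rightarrow> 'a clifford"
  assume X: "Cauchy X"
  have "Cauchy (\<lambda>n. coeff (X n) S)" for S
  proof (rule CauchyI)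
    fix e :: real assume "e > 0"
    then obtain M where M: "\<And>m n. m \<ge> M \<Longrightarrow> n \<ge> M \<Longrightarrow> norm (X m - X n) < e"
      using CauchyD[OF X] by blast
    have "norm (coeff (X m) S - coeff (X n) S) < e" if "m \<ge> M" "n \<ge> M" for m n
      using norm_coeff_le[of "X m - X n" S] M[OF that] by simp
    thus "\<exists>M. \<forall>m\<ge>M. \<forall>n\<ge>M. norm (coeff (X m) S - coeff (X n) S) < e" by blast
  qed
  hence "convergent (\<lambda>n. coeff (X n) S)" for S by (rule Cauchy_convergent)
  then obtain l where l: "\<And>S. (\<lambda>n. coeff (X n) S) \<longlonglongrightarrow> l S"
    unfolding convergent_def by metis
  have "(\<lambda>n. norm (X n - of_coeff l)) \<longlonglongrightarrow> (\<Sum>S\<in>(UNIV :: 'a set set). norm (l S - l S))"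
    unfolding norm_clifford_def coeff_simps coeff_of_coeff
    by (intro tendsto_intros l)
  hence "X \<longlonglongrightarrow> of_coeff l"
    by (simp add: tendsto_norm_zero_iff LIM_zero_iff)
  thus "convergent X" unfolding convergent_def by blast
qed

section \<open>Exponential and trace of operators\<close>

definition op_exp :: "('a::real_normed_vector \<Rightarrow> 'a) \<Rightarrow> 'a \<Rightarrow> 'a" where
  "op_exp A = (\<lambda>v. \<Sum>k. (A ^^ k) v /\<^sub>R fact k)"

definition op_matrix ::
  "('n::{finite,linorder} clifford \<Rightarrow> 'n clifford) \<Rightarrow> complex ^ ('n set) ^ ('n set)" where
  "op_matrix A = (\<chi> S T. coeff (A (chi_prod T)) S)"

definition op_trace :: "('n::{finite,linorder} clifford \<Rightarrow> 'n clifford) \<Rightarrow> complex" where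
  "op_trace A = trace (op_matrix A)"

definition left_mult :: "'n::{finite,linorder} clifford \<Rightarrow> 'n clifford \<Rightarrow> 'n clifford" where
  "left_mult x = (\<lambda>y. x * y)"

text \<open>The exponential series of a left multiplication operator converges.\<close>

lemma op_exp_left_mult_sums:
  fixes x v :: "'n::{finite,linorder} clifford"
  shows "(\<lambda>k. ((\<lambda>y. \<beta> *\<^sub>R left_mult x y) ^^ k) v /\<^sub>R fact k) sums (exp (\<beta> *\<^sub>R x) * v)"
proof -
  have "((\<lambda>y. \<beta> *\<^sub>R left_mult x y) ^^ k) v = (\<beta> *\<^sub>R x) ^ k * v" for k
    by (induction k) (simp_all add: left_mult_def mult.assoc)
  thus ?thesis
    using sums_mult2[OF exp_converges[of "\<beta> *\<^sub>R x"], of v] by simp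
qed

section \<open>The SYK model\<close>

text \<open>
  Index tuples \<open>i\<^sub>1 < \<dots> < i\<^sub>q\<close> are identified with the subsets \<open>S\<close> of cardinality \<open>q\<close>; then
  \<open>chi_prod S\<close> is \<open>\<chi>\<^bsub>i\<^sub>1\<^esub> \<cdots> \<chi>\<^bsub>i\<^sub>q\<^esub>\<close>.
\<close>

definition syk_element :: "nat \<Rightarrow> ('n::{finite,linorder} set \<Rightarrow> real) \<Rightarrow> 'n clifford" where
  "syk_element q J = cscale (\<i> ^ (q div 2)) (\<Sum>S | card S = q. J S *\<^sub>R chi_prod S)"

definition syk_hamiltonian ::
  "nat \<Rightarrow> ('n::{finite,linorder} set \<Rightarrow> real) \<Rightarrow> 'n clifford \<Rightarrow> 'n clifford" where
  "syk_hamiltonian q J = left_mult (syk_element q J)"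

text \<open>
  For even \<open>q\<close> the Hamiltonian is Hermitian, so the trace below is a positive real number and
  \<open>Re\<close> only changes its type.
\<close>

definition syk_free_energy ::
  "'w measure \<Rightarrow> ('n::{finite,linorder} set \<Rightarrow> 'w \<Rightarrow> real) \<Rightarrow> nat \<Rightarrow> real \<Rightarrow> real" where
  "syk_free_energy M J q \<beta> =
    (\<integral>\<omega>. ln (Re (op_trace (op_exp (\<lambda>y. \<beta> *\<^sub>R syk_hamiltonian q (\<lambda>S. J S \<omega>) y)) / 2 ^ CARD('n))) \<partial>M)"

end

theory Submission
  imports Defs
begin

text \<open>
  Write \<open>\<tau>\<close> for the normalized trace, which on a left multiplication operator is the coefficient of
  \<open>1\<close>, and \<open>H(J)\<close> for the SYK element with couplings \<open>J\<close>; thus \<open>F(\<beta>) = E ln \<tau>(exp(\<beta> H(J)))\<close>.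
  Let \<open>J'\<close> be an independent copy of \<open>J\<close>. A sum of independent Gaussians is Gaussian with added
  variances and \<open>H\<close> is linear, so \<open>\<surd>(\<beta>\<^sub>1\<^sup>2 + \<beta>\<^sub>2\<^sup>2) H(J)\<close> has the law of \<open>A + B\<close>, where
  \<open>A = \<beta>\<^sub>1 H(J)\<close> and \<open>B = \<beta>\<^sub>2 H(J')\<close>. For even \<open>q\<close> both are self-adjoint, and the Golden--Thompson
  inequality (\<open>golden_thompson\<close>) gives \<open>\<tau>(exp(A + B)) \<le> \<tau>(exp A exp B)\<close>.

  It remains to separate the two exponentials, and the symmetry of the Gaussian does this. For a set
  \<open>T\<close> of indices, replacing \<open>\<chi>\<^sub>i\<close> by \<open>-\<chi>\<^sub>i\<close> for \<open>i \<in> T\<close> defines an automorphism \<open>flip T\<close> of the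
  algebra. It only changes the signs of some couplings in \<open>B\<close>, hence
  \<open>E ln \<tau>(exp A exp B) = E ln \<tau>(exp A flip T (exp B))\<close> for every \<open>T\<close>. The average of \<open>flip T\<close> over
  all \<open>T\<close> kills every \<open>\<chi>\<^sub>S\<close> with \<open>S\<close> nonempty, that is, it maps \<open>x\<close> to \<open>\<tau>(x) 1\<close>. By concavity
  of the logarithm the average over \<open>T\<close> of \<open>ln \<tau>(exp A flip T (exp B))\<close> is at most
  \<open>ln (\<tau>(exp A) \<tau>(exp B))\<close> (\<open>sum_ln_ntrace_flip_le\<close>), whose expectation is
  \<open>F(\<beta>\<^sub>1) + F(\<beta>\<^sub>2)\<close>.

  All logarithms that occur are integrable, since \<open>ln \<tau>(exp A exp B)\<close> is bounded in absolute value by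
  \<open>\<parallel>A\<parallel> + \<parallel>B\<parallel>\<close> plus a constant (\<open>ntrace_exp_times_exp\<close>) and the norms are sums of absolute values of
  Gaussians.
\<close>

section \<open>The normalized trace\<close>

definition ntrace :: "'n::{finite,linorder} clifford \<Rightarrow> complex" where
  "ntrace x = coeff x {}"

lemma ntrace_times: "ntrace (x * y) = (\<Sum>S\<in>UNIV. reorder_sign S S * coeff x S * coeff y S)"
  by (simp add: ntrace_def coeff_times)

lemma ntrace_commute: "ntrace (x * y) = ntrace (y * x)"
  by (simp add: ntrace_times mult_ac)

text \<open>
  Multiplying \<open>\<chi>\<^sub>S\<close> by \<open>\<chi>\<^sub>T\<close> gives a multiple of \<open>\<chi>\<^sub>S\<close> only for \<open>T = {}\<close>. Hence all diagonal entries of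
  a left multiplication operator are equal to the coefficient of \<open>1\<close>.
\<close>

lemma op_trace_exp_left_mult:
  fixes x :: "'n::{finite,linorder} clifford"
  shows "op_trace (op_exp (\<lambda>y. \<beta> *\<^sub>R left_mult x y)) = 2 ^ CARD('n) * ntrace (exp (\<beta> *\<^sub>R x))"
proof -
  let ?e = "exp (\<beta> *\<^sub>R x)"
  have op: "op_exp (\<lambda>y. \<beta> *\<^sub>R left_mult x y) = (\<lambda>v. ?e * v)"
    unfolding op_exp_def by (rule ext) (rule sums_unique[OF op_exp_left_mult_sums, symmetric])
  have diag: "coeff (?e * chi_prod S) S = ntrace ?e" for S :: "'n set"
  proof -
    have "sym_diff T S = S \<longleftrightarrow> T = {}" for T :: "'n set" by auto
    note iff = this
    have "coeff (?e * chi_prod S) S = (\<Sum>T\<in>(UNIV :: 'n set set). if T = {} then coeff ?e {} else 0)"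
      unfolding coeff_times coeff_chi_prod iff by (intro sum.cong) simp_all
    thus ?thesis by (simp add: ntrace_def)
  qed
  show ?thesis
    by (simp add: op op_trace_def op_matrix_def trace_def diag card_UNIV_set)
qed

text \<open>
  The norm of the inner product \<open>(x, y) \<mapsto> ntrace (x * star y)\<close>, for which the \<open>\<chi>\<^sub>S\<close> are
  orthonormal; up to normalization it is the Hilbert--Schmidt norm of the operator of left
  multiplication.
\<close>

definition hs_norm :: "'n::{finite,linorder} clifford \<Rightarrow> real" where
  "hs_norm x = L2_set (\<lambda>S. norm (coeff x S)) UNIV"

lemma hs_norm_nonneg: "hs_norm x \<ge> 0"
  by (simp add: hs_norm_def)

lemma hs_norm_star: "hs_norm (star x) = hs_norm x"
  by (simp add: hs_norm_def star_def norm_mult)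

lemma ntrace_times_star: "ntrace (x * star x) = of_real ((hs_norm x)\<^sup>2)"
proof -
  have "ntrace (x * star x) = (\<Sum>S\<in>UNIV. (reorder_sign S S * reorder_sign S S) *
      (coeff x S * cnj (coeff x S)))"
    unfolding ntrace_times by (intro sum.cong) (simp_all add: star_def mult_ac)
  also have "\<dots> = (\<Sum>S\<in>UNIV. of_real ((norm (coeff x S))\<^sup>2))"
    by (simp only: reorder_sign_square complex_norm_square mult_1_left)
  finally show ?thesis by (simp add: hs_norm_def L2_set_def sum_nonneg)
qed

lemma norm_ntrace_times_star: "norm (ntrace (x * star x)) = (hs_norm x)\<^sup>2"
  by (simp add: ntrace_times_star norm_power)

lemma norm_ntrace_times_le: "norm (ntrace (x * y)) \<le> hs_norm x * hs_norm y"
proof -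
  have "norm (ntrace (x * y)) \<le> (\<Sum>S\<in>UNIV. norm (coeff x S) * norm (coeff y S))"
    unfolding ntrace_times by (rule order.trans[OF norm_sum]) (simp add: norm_mult)
  also have "\<dots> \<le> hs_norm x * hs_norm y"
    unfolding hs_norm_def using L2_set_mult_ineq[of "\<lambda>S. norm (coeff x S)" "\<lambda>S. norm (coeff y S)" UNIV] by simp
  finally show ?thesis .
qed

lemma ntrace_power_commute: "ntrace ((x * y) ^ m) = ntrace ((y * x) ^ m)"
proof (cases m)
  case (Suc k)
  have "(x * y) ^ j * x = x * (y * x) ^ j" for j
    by (induction j) (simp_all add: mult.assoc)
  hence "(x * y) ^ Suc k = x * ((y * x) ^ k * y)"
    by (simp only: power_Suc2 mult.assoc[symmetric])
  hence "ntrace ((x * y) ^ Suc k) = ntrace ((y * x) ^ k * y * x)"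
    using ntrace_commute[of x "(y * x) ^ k * y"] by simp
  also have "(y * x) ^ k * y * x = (y * x) ^ Suc k"
    by (simp only: power_Suc2 mult.assoc)
  finally show ?thesis by (simp add: Suc)
qed simp

lemma hs_norm_le_norm: "hs_norm x \<le> norm x"
  unfolding hs_norm_def norm_clifford_def by (rule L2_set_le_sum) simp

lemma norm_le_hs_norm:
  "(norm x)\<^sup>2 \<le> 2 ^ CARD('n) * (hs_norm x)\<^sup>2" for x :: "'n::{finite,linorder} clifford"
proof -
  have "norm x \<le> L2_set (\<lambda>S. norm (coeff x S)) UNIV * L2_set (\<lambda>_. 1) (UNIV :: 'n set set)"
    using L2_set_mult_ineq[of "\<lambda>S. norm (coeff x S)" "\<lambda>_. 1" UNIV] by (simp add: norm_clifford_def)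
  hence "(norm x)\<^sup>2 \<le> (hs_norm x * L2_set (\<lambda>_. 1) (UNIV :: 'n set set))\<^sup>2"
    unfolding hs_norm_def by (rule power_mono) simp
  thus ?thesis by (simp add: power_mult_distrib L2_set_def card_UNIV_set mult.commute)
qed

lemma star_zero: "star 0 = 0"
  by (rule clifford_eqI) (simp add: star_def)

lemma star_one: "star 1 = 1"
  by (rule clifford_eqI) (simp add: star_def coeff_one)

lemma star_power: "star (x ^ k) = star x ^ k"
  by (induction k) (simp_all add: star_one star_times power_commutes)

text \<open>
  Only powers of the single element \<open>x\<close> enter the exponential series, so the same lemma serves
  homomorphisms such as \<open>flip T\<close> and antihomomorphisms such as \<open>star\<close>.
\<close>

lemma exp_power_hom:
  fixes f :: "'a::{real_normed_algebra_1,banach} \<Rightarrow> 'b::{real_normed_algebra_1,banach}"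
  assumes "bounded_linear f" and "\<And>k. f (x ^ k) = f x ^ k"
  shows "f (exp x) = exp (f x)"
proof -
  have "(\<lambda>k. f (x ^ k /\<^sub>R fact k)) sums f (exp x)"
    by (rule bounded_linear.sums[OF assms(1) exp_converges])
  hence "(\<lambda>k. f x ^ k /\<^sub>R fact k) sums f (exp x)"
    by (simp add: linear_cmul[OF bounded_linear.linear[OF assms(1)]] assms(2))
  thus ?thesis using exp_converges sums_unique2 by blast
qed

lemma star_exp: "star (exp x) = exp (star x)"
proof (rule exp_power_hom)
  show "bounded_linear (star :: 'a clifford \<Rightarrow> _)"
    by (rule bounded_linear_intro[where K = 1])
      (simp_all add: star_plus scaleR_cscale star_cscale,
       simp add: norm_clifford_def star_def norm_mult)
qed (rule star_power)

lemma bounded_linear_coeff: "bounded_linear (\<lambda>x :: 'n::finite clifford. coeff x S)"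
  by (rule bounded_linear_intro[where K = 1]) (simp_all add: norm_coeff_le scaleR_conv_of_real)

section \<open>The Golden--Thompson inequality\<close>

text \<open>
  Two trace inequalities that feed each other. The first at \<open>k + 1\<close> starts from its
  instance at \<open>k\<close> for \<open>x\<^sup>2\<close>: by cyclicity the right hand side is the trace of a power of \<open>(x x\<^sup>*) (x\<^sup>* x)\<close>, where the
  second inequality separates the factors and Cauchy--Schwarz recombines them, because \<open>x x\<^sup>*\<close> and
  \<open>x\<^sup>* x\<close> have powers of equal trace. The second at \<open>k + 1\<close> applies the first to \<open>x = a b\<close>, which
  produces by cyclicity the product \<open>a\<^sup>2 b\<^sup>2\<close>, and then its own instance at \<open>k\<close> for \<open>a\<^sup>2\<close> and \<open>b\<^sup>2\<close>.
  Absolute values are taken throughout, since \<open>a\<close> and \<open>b\<close> are only self-adjoint and the traces of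
  the products need not be positive.
\<close>

lemma ntrace_dyadic_power_le:
  fixes x a b :: "'n::{finite,linorder} clifford"
  shows "norm (ntrace (x ^ 2 ^ Suc k)) \<le> norm (ntrace ((x * star x) ^ 2 ^ k))"
    and "star a = a \<Longrightarrow> star b = b \<Longrightarrow>
      norm (ntrace ((a * b) ^ 2 ^ k)) \<le> norm (ntrace (a ^ 2 ^ k * b ^ 2 ^ k))"
proof (induction k arbitrary: x a b)
  case 0
  {
    case 1
    show ?case
      using norm_ntrace_times_le[of x x] norm_ntrace_times_star[of x] by (simp add: power2_eq_square)
  next
    case (2 a b)
    show ?case by simp
  }
next
  case (Suc k)
  let ?m = "2 ^ k :: nat"
  {
    case 1
    define p q where "p = x * star x" and "q = star x * x"
    have sa: "star p = p" "star q = q" by (simp_all add: p_def q_def star_times star_star)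
    have hs: "(hs_norm (y ^ ?m))\<^sup>2 = norm (ntrace (y ^ 2 ^ Suc k))" if "star y = y" for y :: "'n clifford"
      using norm_ntrace_times_star[of "y ^ ?m"] that
      by (simp add: star_power mult_2 flip: power_add)
    have eq: "hs_norm (q ^ ?m) = hs_norm (p ^ ?m)"
      using hs[OF sa(1)] hs[OF sa(2)] ntrace_power_commute[of x "star x" "2 ^ Suc k"]
      by (metis p_def q_def hs_norm_nonneg power2_eq_iff_nonneg)
    have "norm (ntrace (x ^ 2 ^ Suc (Suc k))) = norm (ntrace ((x * x) ^ 2 ^ Suc k))"
      by (simp add: power_mult power4_eq_xxxx power2_eq_square mult.assoc)
    also have "\<dots> \<le> norm (ntrace ((x * (x * star x * star x)) ^ ?m))"
      using Suc.IH(1)[of "x * x"] by (simp add: star_times mult.assoc)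
    also have "\<dots> = norm (ntrace ((p * q) ^ ?m))"
      by (subst ntrace_power_commute) (simp add: p_def q_def mult.assoc)
    also have "\<dots> \<le> hs_norm (p ^ ?m) * hs_norm (q ^ ?m)"
      using Suc.IH(2)[OF sa] norm_ntrace_times_le order.trans by blast
    also have "\<dots> = norm (ntrace (p ^ 2 ^ Suc k))"
      using hs[OF sa(1)] eq by (simp add: power2_eq_square)
    finally show ?case by (simp add: p_def)
  next
    case (2 a b)
    have "norm (ntrace ((a * b) ^ 2 ^ Suc k)) \<le> norm (ntrace ((a * b * b * a) ^ ?m))"
      using Suc.IH(1)[of "a * b"] 2 by (simp add: star_times mult.assoc)
    also have "\<dots> = norm (ntrace (((a * a) * (b * b)) ^ ?m))"
      by (subst ntrace_power_commute) (simp add: mult.assoc)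
    also have "\<dots> \<le> norm (ntrace ((a * a) ^ ?m * (b * b) ^ ?m))"
      by (rule Suc.IH(2)) (simp_all add: star_times 2)
    finally show ?case by (simp add: power_mult power2_eq_square)
  }
qed

lemma norm_power_diff_le:
  fixes x y :: "'a::real_normed_algebra_1"
  assumes "norm x \<le> K" "norm y \<le> K" "K \<ge> 1"
  shows "norm (x ^ m - y ^ m) \<le> real m * norm (x - y) * K ^ m"
proof (induction m)
  case (Suc m)
  have "x ^ Suc m - y ^ Suc m = x * (x ^ m - y ^ m) + (x - y) * y ^ m"
    by (simp add: algebra_simps)
  also have "norm \<dots> \<le> norm x * norm (x ^ m - y ^ m) + norm (x - y) * norm (y ^ m)"
    by (intro norm_triangle_mono norm_mult_ineq)
  also have "\<dots> \<le> K * (real m * norm (x - y) * K ^ m) + norm (x - y) * (K * K ^ m)"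
  proof -
    have "norm (y ^ m) \<le> K ^ m"
      using norm_power_ineq[of y m] power_mono[OF assms(2), of m] by simp
    also have "\<dots> \<le> K * K ^ m" using assms(3) by simp
    finally show ?thesis
      using assms Suc by (intro add_mono mult_mono) (auto intro: mult_nonneg_nonneg)
  qed
  also have "\<dots> = real (Suc m) * norm (x - y) * K ^ Suc m"
    by (simp add: algebra_simps)
  finally show ?case .
qed simp

lemma exp_power: "exp x ^ m = exp (real m *\<^sub>R x)" for x :: "'a::{real_normed_algebra_1,banach}"
proof (induction m)
  case (Suc m)
  have "exp (real (Suc m) *\<^sub>R x) = exp (x + real m *\<^sub>R x)" by (simp add: algebra_simps)
  also have "\<dots> = exp x * exp (real m *\<^sub>R x)" by (rule exp_add_commuting) simp
  finally show ?case by (simp add: Suc)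
qed simp

text \<open>
  With \<open>f\<close> and \<open>h\<close> the two exponential expressions at step \<open>1/m\<close>, so that \<open>h\<^sup>m = exp (A + B)\<close>,
  telescoping bounds \<open>f\<^sup>m - h\<^sup>m\<close> by \<open>m \<parallel>f - h\<parallel>\<close> times a constant. This tends to \<open>0\<close> because the curves
  \<open>exp (t A) exp (t B)\<close> and \<open>exp (t (A + B))\<close> have the same derivative at \<open>t = 0\<close>.
\<close>

lemma lie_trotter:
  fixes A B :: "'a::{real_normed_algebra_1,banach}"
  shows "(\<lambda>m. (exp (A /\<^sub>R real m) * exp (B /\<^sub>R real m)) ^ m) \<longlonglongrightarrow> exp (A + B)"
proof -
  define g where "g t = exp (t *\<^sub>R A) * exp (t *\<^sub>R B) - exp (t *\<^sub>R (A + B))" for t :: real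
  let ?f = "\<lambda>m. exp (A /\<^sub>R real m) * exp (B /\<^sub>R real m)"
  let ?K = "exp (norm A + norm B)"
  have "(g has_vector_derivative 0) (at 0)"
    unfolding g_def
    by (rule derivative_eq_intros exp_scaleR_has_vector_derivative_right
      has_vector_derivative_mult refl)+ simp
  hence "((\<lambda>t. g t /\<^sub>R \<bar>t\<bar>) \<longlongrightarrow> 0) (at 0)"
    by (simp add: has_vector_derivative_def has_derivative_at_within g_def)
  hence "((\<lambda>t. norm (g t /\<^sub>R t)) \<longlongrightarrow> 0) (at 0)"
    by (subst (asm) tendsto_norm_zero_iff[symmetric]) simp
  hence "((\<lambda>t. g t /\<^sub>R t) \<longlongrightarrow> 0) (at 0)"
    by (rule tendsto_norm_zero_cancel)
  moreover have "filterlim (\<lambda>m. 1 / real m) (at 0) sequentially"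
    by (intro filterlim_atI lim_1_over_n eventually_mono[OF eventually_gt_at_top[of 0]]) auto
  ultimately have lim: "(\<lambda>m. g (1 / real m) /\<^sub>R (1 / real m)) \<longlonglongrightarrow> 0"
    by (rule filterlim_compose)
  have bound: "norm (?f m ^ m - exp (A + B)) \<le> norm (g (1 / real m) /\<^sub>R (1 / real m)) * ?K"
    if "m > 0" for m
  proof -
    let ?c = "exp ((norm A + norm B) / real m)"
    have e: "exp (A + B) = exp ((A + B) /\<^sub>R real m) ^ m" using that by (simp add: exp_power)
    have "norm (?f m) \<le> norm (exp (A /\<^sub>R real m)) * norm (exp (B /\<^sub>R real m))"
      by (rule norm_mult_ineq)
    also have "\<dots> \<le> exp (norm (A /\<^sub>R real m)) * exp (norm (B /\<^sub>R real m))"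
      by (intro mult_mono norm_exp) auto
    also have "\<dots> = ?c" by (simp add: exp_add[symmetric] divide_simps)
    finally have 1: "norm (?f m) \<le> ?c" .
    have "norm (exp ((A + B) /\<^sub>R real m)) \<le> exp (norm ((A + B) /\<^sub>R real m))" by (rule norm_exp)
    also have "\<dots> \<le> ?c" using norm_triangle_ineq[of A B] by (simp add: divide_simps)
    finally have 2: "norm (exp ((A + B) /\<^sub>R real m)) \<le> ?c" .
    have "norm (?f m ^ m - exp (A + B)) \<le> real m * norm (g (1 / real m)) * ?c ^ m"
      unfolding e using norm_power_diff_le[OF 1 2, of m]
      by (simp add: g_def inverse_eq_divide)
    also have "?c ^ m = ?K" using that by (simp add: exp_of_nat_mult[symmetric])
    finally show ?thesis by (simp add: mult_ac)
  qed
  have "(\<lambda>m. norm (g (1 / real m) /\<^sub>R (1 / real m)) * ?K) \<longlonglongrightarrow> norm (0 :: 'a) * ?K"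
    by (intro tendsto_intros lim)
  hence "(\<lambda>m. ?f m ^ m - exp (A + B)) \<longlonglongrightarrow> 0"
    by (intro Lim_null_comparison[OF eventually_mono[OF eventually_gt_at_top[of 0] bound]]) auto
  thus ?thesis by (simp add: LIM_zero_iff)
qed

text \<open>
  Apply the second inequality of \<open>ntrace_dyadic_power_le\<close> to \<open>a = exp (A / 2\<^sup>k)\<close> and
  \<open>b = exp (B / 2\<^sup>k)\<close>: its right hand side does not depend on \<open>k\<close>, and its left hand side converges by
  the Lie--Trotter formula.
\<close>

theorem golden_thompson:
  fixes A B :: "'n::{finite,linorder} clifford"
  assumes "star A = A" "star B = B"
  shows "norm (ntrace (exp (A + B))) \<le> norm (ntrace (exp A * exp B))"
proof (rule LIMSEQ_le_const2)
  let ?f = "\<lambda>m. (exp (A /\<^sub>R real m) * exp (B /\<^sub>R real m)) ^ m"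
  have "(\<lambda>k. ?f (2 ^ k)) \<longlonglongrightarrow> exp (A + B)"
    by (rule filterlim_compose[OF lie_trotter])
      (rule filterlim_subseq, simp add: strict_mono_def)
  thus "(\<lambda>k. norm (ntrace (?f (2 ^ k)))) \<longlonglongrightarrow> norm (ntrace (exp (A + B)))"
    unfolding ntrace_def by (intro tendsto_norm bounded_linear.tendsto[OF bounded_linear_coeff])
  have "norm (ntrace (?f (2 ^ k))) \<le> norm (ntrace (exp A * exp B))" for k
  proof -
    have sa: "star (exp (x /\<^sub>R real (2 ^ k))) = exp (x /\<^sub>R real (2 ^ k))" if "star x = x"
      for x :: "'n clifford"
      using that by (simp add: star_exp scaleR_cscale star_cscale)
    show ?thesis
      using ntrace_dyadic_power_le(2)[OF sa[OF assms(1)] sa[OF assms(2)], of k]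
      by (simp add: exp_power)
  qed
  thus "\<exists>N. \<forall>k\<ge>N. norm (ntrace (?f (2 ^ k))) \<le> norm (ntrace (exp A * exp B))" by blast
qed

section \<open>Averaging over sign changes of the generators\<close>

text \<open>
  The sign \<open>(-1)\<^bsup>|S \<inter> T|\<^esup>\<close>. As a product over \<open>S\<close> it is visibly a character for the symmetric
  difference.
\<close>

definition flip_sign :: "'n set \<Rightarrow> 'n set \<Rightarrow> real" where
  "flip_sign T S = (\<Prod>s\<in>S. if s \<in> T then -1 else 1)"

text \<open>
  The automorphism with \<open>\<chi>\<^sub>i \<mapsto> -\<chi>\<^sub>i\<close> for \<open>i \<in> T\<close> and \<open>\<chi>\<^sub>i \<mapsto> \<chi>\<^sub>i\<close> for \<open>i \<notin> T\<close>.
\<close>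

definition flip :: "'n set \<Rightarrow> 'n clifford \<Rightarrow> 'n clifford" where
  "flip T x = of_coeff (\<lambda>S. of_real (flip_sign T S) * coeff x S)"

lemma coeff_flip [simp]: "coeff (flip T x) S = of_real (flip_sign T S) * coeff x S"
  by (simp add: flip_def)

lemma abs_flip_sign [simp]: "\<bar>flip_sign T S\<bar> = 1"
  unfolding flip_sign_def abs_prod by (intro prod.neutral) auto

lemma flip_sign_sym_diff:
  fixes A B :: "'n::finite set"
  shows "flip_sign T (sym_diff A B) = flip_sign T A * flip_sign T B"
proof -
  have "complex_of_real (flip_sign T (sym_diff A B)) =
      of_real (flip_sign T A) * of_real (flip_sign T B)"
    unfolding flip_sign_def of_real_prod by (rule prod_sym_diff) auto
  thus ?thesis by (metis of_real_eq_iff of_real_mult)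
qed

lemma flip_sign_empty [simp]: "flip_sign {} S = 1"
  by (simp add: flip_sign_def)

lemma flip_empty [simp]: "flip {} x = x"
  by (rule clifford_eqI) simp

lemma flip_one: "flip T 1 = 1"
  by (rule clifford_eqI) (simp add: coeff_one flip_sign_def)

lemma flip_times: "flip T (x * y) = flip T x * flip T y"
proof (rule clifford_eqI)
  fix U
  have sign: "flip_sign T U = flip_sign T S * flip_sign T (sym_diff S U)" for S
  proof -
    have "sym_diff S (sym_diff S U) = U" by auto
    thus ?thesis using flip_sign_sym_diff[of T S "sym_diff S U"] by (simp only:)
  qed
  have "coeff (flip T (x * y)) U = (\<Sum>S\<in>UNIV. of_real (flip_sign T S * flip_sign T (sym_diff S U)) *
      (reorder_sign S (sym_diff S U) * coeff x S * coeff y (sym_diff S U)))"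
    unfolding coeff_flip coeff_times sum_distrib_left
    by (intro sum.cong refl, subst sign) (rule refl)
  also have "\<dots> = coeff (flip T x * flip T y) U"
    unfolding coeff_times by (intro sum.cong) (simp_all add: mult_ac)
  finally show "coeff (flip T (x * y)) U = coeff (flip T x * flip T y) U" .
qed

lemma flip_power: "flip T (x ^ k) = flip T x ^ k"
  by (induction k) (simp_all add: flip_one flip_times)

lemma norm_flip [simp]: "norm (flip T x) = norm x"
  by (simp add: norm_clifford_def norm_mult)

lemma flip_exp: "flip T (exp x) = exp (flip T x)"
proof (rule exp_power_hom)
  show "bounded_linear (flip T)"
    by (rule bounded_linear_intro[where K = 1]) (auto intro!: clifford_eqI simp: algebra_simps)
qed (rule flip_power)

lemma star_flip: "star (flip T x) = flip T (star x)"
  by (rule clifford_eqI) (simp add: star_def mult_ac)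

text \<open>
  For \<open>s \<in> S\<close>, adding \<open>s\<close> to or removing it from \<open>T\<close> reverses the sign, so the terms cancel in
  pairs.
\<close>

lemma sum_flip_sign:
  fixes S :: "'n::finite set"
  shows "(\<Sum>T\<in>UNIV. flip_sign T S) = (if S = {} then 2 ^ CARD('n) else 0)"
proof (cases "S = {}")
  case True
  thus ?thesis by (simp add: flip_sign_def card_UNIV_set)
next
  case False
  then obtain s where s: "s \<in> S" by auto
  have "flip_sign (sym_diff {s} T) S = - flip_sign T S" for T
  proof -
    have "(if t \<in> sym_diff {s} T then -1 else 1 :: real) =
        (if t = s then -1 else 1) * (if t \<in> T then -1 else 1)" for t
      by (cases "t = s"; cases "t \<in> T") simp_all
    hence "flip_sign (sym_diff {s} T) S =
        (\<Prod>t\<in>S. (if t = s then -1 else 1) * (if t \<in> T then -1 else 1))"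
      unfolding flip_sign_def by (simp only:)
    also have "\<dots> = - flip_sign T S"
      using s by (simp add: prod.distrib flip_sign_def)
    finally show ?thesis .
  qed
  hence "(\<Sum>T\<in>UNIV. flip_sign T S) = - (\<Sum>T\<in>UNIV. flip_sign T S)"
    using sum_sym_diff[of "\<lambda>T. flip_sign T S" "{s}"] by (simp only: sum_negf)
  hence "(\<Sum>T\<in>UNIV. flip_sign T S) = 0" by (simp only: equal_neg_zero)
  thus ?thesis using False by simp
qed

text \<open>
  Averaging over all sign changes leaves only the scalar part of \<open>y\<close>, and so decouples \<open>x\<close> from
  \<open>y\<close>.
\<close>

lemma sum_ntrace_flip:
  fixes x y :: "'n::{finite,linorder} clifford"
  shows "(\<Sum>T\<in>UNIV. ntrace (x * flip T y)) = 2 ^ CARD('n) * (ntrace x * ntrace y)"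
proof -
  have "(\<Sum>T\<in>UNIV. ntrace (x * flip T y)) = (\<Sum>S\<in>UNIV. \<Sum>T\<in>UNIV.
      of_real (flip_sign T S) * (reorder_sign S S * coeff x S * coeff y S))"
    unfolding ntrace_times by (subst sum.swap) (simp add: mult_ac)
  also have "\<dots> = (\<Sum>S\<in>UNIV. of_real (\<Sum>T\<in>UNIV. flip_sign T S) *
      (reorder_sign S S * coeff x S * coeff y S))"
    by (simp add: sum_distrib_right)
  also have "\<dots> = (\<Sum>S\<in>UNIV. if S = {} then 2 ^ CARD('n) * (coeff x S * coeff y S) else 0)"
    unfolding sum_flip_sign by (intro sum.cong) auto
  finally show ?thesis by (simp add: ntrace_def)
qed

section \<open>Bounds on the trace of a product of exponentials\<close>

text \<open>
  With \<open>y = exp (A/2) exp (B/2)\<close>, cyclicity of the trace gives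
  \<open>ntrace (exp A * exp B) = ntrace (y * star y)\<close>, the square of the Hilbert--Schmidt norm of \<open>y\<close>. This norm is
  equivalent to the algebra norm, and both \<open>y\<close> and its inverse have algebra norm at most
  \<open>exp ((norm A + norm B) / 2)\<close>. Taking \<open>B = 0\<close> gives the same facts for a single exponential.
\<close>

lemma ntrace_exp_times_exp:
  fixes A B :: "'n::{finite,linorder} clifford"
  assumes "star A = A" "star B = B"
  shows "ntrace (exp A * exp B) = of_real (Re (ntrace (exp A * exp B)))"
    and "Re (ntrace (exp A * exp B)) > 0"
    and "\<bar>ln (Re (ntrace (exp A * exp B)))\<bar> \<le> norm A + norm B + CARD('n) * ln 2"
proof -
  define a b where "a = exp (A /\<^sub>R 2)" and "b = exp (B /\<^sub>R 2)"
  have half: "exp x = exp (x /\<^sub>R 2) * exp (x /\<^sub>R 2)" for x :: "'n clifford"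
    using exp_power[of "x /\<^sub>R 2" 2] by (simp add: power2_eq_square)
  have ab: "star a = a" "star b = b"
    using assms by (simp_all add: a_def b_def star_exp scaleR_cscale star_cscale)
  have "ntrace (exp A * exp B) = ntrace (a * (a * b * b))"
    by (simp add: half[of A] half[of B] a_def b_def mult.assoc)
  also have "\<dots> = ntrace ((a * b) * star (a * b))"
    by (subst ntrace_commute) (simp add: star_times ab mult.assoc)
  finally have eq: "ntrace (exp A * exp B) = of_real ((hs_norm (a * b))\<^sup>2)"
    by (simp only: ntrace_times_star)
  thus "ntrace (exp A * exp B) = of_real (Re (ntrace (exp A * exp B)))" by simp
  have Re: "Re (ntrace (exp A * exp B)) = (hs_norm (a * b))\<^sup>2" using eq by simp
  let ?s = "norm A + norm B"
  have "1 = norm (exp (- (B /\<^sub>R 2)) * exp (- (A /\<^sub>R 2)) * (a * b))"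
  proof -
    have inv: "exp (- x) * exp x = 1" for x :: "'n clifford"
      using exp_minus_inverse[of "- x"] by simp
    have "exp (- (B /\<^sub>R 2)) * exp (- (A /\<^sub>R 2)) * (a * b) =
        exp (- (B /\<^sub>R 2)) * (exp (- (A /\<^sub>R 2)) * a) * b"
      by (simp only: mult.assoc)
    thus ?thesis by (simp add: a_def b_def inv)
  qed
  also have "\<dots> \<le> exp (norm B / 2) * exp (norm A / 2) * norm (a * b)"
    using norm_exp[of "- (B /\<^sub>R 2)"] norm_exp[of "- (A /\<^sub>R 2)"]
    by (intro order.trans[OF norm_mult_ineq mult_right_mono[OF order.trans[OF norm_mult_ineq]]]
        mult_mono) auto
  also have "\<dots> = exp (?s / 2) * norm (a * b)"
    by (simp add: add_divide_distrib exp_add)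
  finally have "1 \<le> (exp (?s / 2) * norm (a * b))\<^sup>2"
    by (metis one_le_power)
  also have "\<dots> = exp ?s * (norm (a * b))\<^sup>2"
    by (simp add: power_mult_distrib exp_double[symmetric])
  also have "\<dots> \<le> exp ?s * (2 ^ CARD('n) * (hs_norm (a * b))\<^sup>2)"
    using norm_le_hs_norm by (intro mult_left_mono) auto
  finally have low: "1 \<le> exp ?s * 2 ^ CARD('n) * (hs_norm (a * b))\<^sup>2" by (simp add: mult.assoc)
  hence "(hs_norm (a * b))\<^sup>2 \<noteq> 0" by auto
  thus pos: "Re (ntrace (exp A * exp B)) > 0" by (simp add: Re)
  have "ln 1 \<le> ln (exp ?s * 2 ^ CARD('n) * (hs_norm (a * b))\<^sup>2)"
    using low by (subst ln_le_cancel_iff) auto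
  also have "\<dots> = ?s + CARD('n) * ln 2 + ln ((hs_norm (a * b))\<^sup>2)"
    using pos by (simp add: Re ln_mult ln_realpow)
  finally have 1: "- (?s + CARD('n) * ln 2) \<le> ln ((hs_norm (a * b))\<^sup>2)" by simp
  have "hs_norm (a * b) \<le> norm (a * b)" by (rule hs_norm_le_norm)
  also have "\<dots> \<le> exp (norm A / 2) * exp (norm B / 2)"
    using norm_exp[of "A /\<^sub>R 2"] norm_exp[of "B /\<^sub>R 2"] unfolding a_def b_def
    by (intro order.trans[OF norm_mult_ineq] mult_mono) auto
  also have "\<dots> = exp (?s / 2)" by (simp add: add_divide_distrib exp_add)
  finally have "(hs_norm (a * b))\<^sup>2 \<le> (exp (?s / 2))\<^sup>2"
    by (intro power_mono hs_norm_nonneg)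
  also have "\<dots> = exp ?s" by (simp add: exp_double[symmetric])
  finally have "ln ((hs_norm (a * b))\<^sup>2) \<le> ln (exp ?s)"
    using pos by (subst ln_le_cancel_iff) (simp_all add: Re)
  hence 2: "ln ((hs_norm (a * b))\<^sup>2) \<le> ?s + CARD('n) * ln 2" by (simp add: add_increasing2)
  show "\<bar>ln (Re (ntrace (exp A * exp B)))\<bar> \<le> norm A + norm B + CARD('n) * ln 2"
    unfolding Re using 1 2 by (intro abs_leI) auto
qed

text \<open>
  Jensen's inequality for the logarithm and the uniform distribution on \<open>I\<close>; the tangent of \<open>ln\<close> at
  the mean \<open>m\<close> lies above the graph.
\<close>

lemma sum_ln_le:
  fixes x :: "'a \<Rightarrow> real" and m :: real
  assumes "\<And>t. t \<in> I \<Longrightarrow> x t > 0" "(\<Sum>t\<in>I. x t) = card I * m" "m > 0"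
  shows "(\<Sum>t\<in>I. ln (x t)) \<le> card I * ln m"
proof -
  have "ln (x t) \<le> ln m + (x t / m - 1)" if "t \<in> I" for t
    using ln_le_minus_one[of "x t / m"] assms(1)[OF that] assms(3) by (simp add: ln_div)
  hence "(\<Sum>t\<in>I. ln (x t)) \<le> (\<Sum>t\<in>I. ln m + (x t / m - 1))" by (rule sum_mono)
  also have "\<dots> = card I * ln m"
    using assms(2,3) by (simp add: sum.distrib sum_subtractf flip: sum_divide_distrib)
  finally show ?thesis .
qed

lemma sum_ln_ntrace_flip_le:
  fixes A B :: "'n::{finite,linorder} clifford"
  assumes "star A = A" "star B = B"
  shows "(\<Sum>T\<in>UNIV. ln (Re (ntrace (exp A * exp (flip T B))))) \<le>
    2 ^ CARD('n) * (ln (Re (ntrace (exp A))) + ln (Re (ntrace (exp B))))"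
proof -
  have A: "Re (ntrace (exp A)) > 0" "ntrace (exp A) = of_real (Re (ntrace (exp A)))"
    using ntrace_exp_times_exp(1,2)[OF assms(1) star_zero] by simp_all
  have B: "Re (ntrace (exp B)) > 0" "ntrace (exp B) = of_real (Re (ntrace (exp B)))"
    using ntrace_exp_times_exp(1,2)[OF assms(2) star_zero] by simp_all
  have "(\<Sum>T\<in>UNIV. ln (Re (ntrace (exp A * exp (flip T B))))) \<le>
      card (UNIV :: 'n set set) * ln (Re (ntrace (exp A)) * Re (ntrace (exp B)))"
  proof (rule sum_ln_le)
    show "Re (ntrace (exp A * exp (flip T B))) > 0" for T
      by (rule ntrace_exp_times_exp(2)) (simp_all add: assms star_flip)
    have "(\<Sum>T\<in>UNIV. Re (ntrace (exp A * exp (flip T B)))) =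
        Re (2 ^ CARD('n) * (ntrace (exp A) * ntrace (exp B)))"
      unfolding sum_ntrace_flip[symmetric] by (simp add: flip_exp)
    also have "2 ^ CARD('n) * (ntrace (exp A) * ntrace (exp B)) =
        of_real (2 ^ CARD('n) * (Re (ntrace (exp A)) * Re (ntrace (exp B))))"
      by (subst A(2), subst B(2)) simp
    finally show "(\<Sum>T\<in>UNIV. Re (ntrace (exp A * exp (flip T B)))) =
        card (UNIV :: 'n set set) * (Re (ntrace (exp A)) * Re (ntrace (exp B)))"
      by (simp add: card_UNIV_set)
  qed (use A B in simp)
  thus ?thesis using A(1) B(1) by (simp add: card_UNIV_set ln_mult)
qed

section \<open>The SYK element\<close>

lemma coeff_syk_element:
  fixes J :: "'n::{finite,linorder} set \<Rightarrow> real"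
  shows "coeff (syk_element q J) S = (if card S = q then \<i> ^ (q div 2) * of_real (J S) else 0)"
proof -
  have "coeff (syk_element q J) S =
      \<i> ^ (q div 2) * (\<Sum>T | card T = q. if T = S then of_real (J S) else 0)"
    unfolding syk_element_def coeff_cscale coeff_sum coeff_simps coeff_chi_prod
    by (intro arg_cong2[where f = "(*)"] sum.cong) auto
  thus ?thesis by simp
qed

lemma syk_element_cong: "(\<And>S. card S = q \<Longrightarrow> J S = J' S) \<Longrightarrow> syk_element q J = syk_element q J'"
  by (simp add: syk_element_def)

lemma syk_element_add: "syk_element q J + syk_element q J' = syk_element q (\<lambda>S. J S + J' S)"
  by (rule clifford_eqI) (simp add: coeff_syk_element algebra_simps)

lemma syk_element_scaleR: "r *\<^sub>R syk_element q J = syk_element q (\<lambda>S. r * J S)"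
  by (rule clifford_eqI) (simp add: coeff_syk_element)

lemma flip_syk_element: "flip T (syk_element q J) = syk_element q (\<lambda>S. flip_sign T S * J S)"
  by (rule clifford_eqI) (simp add: coeff_syk_element)

lemma norm_syk_element:
  "norm (syk_element q J) = (\<Sum>S | card S = q. \<bar>J S\<bar>)" for J :: "'n::{finite,linorder} set \<Rightarrow> real"
proof -
  have "norm (syk_element q J) = (\<Sum>S\<in>UNIV. if card S = q then \<bar>J S\<bar> else 0)"
    unfolding norm_clifford_def coeff_syk_element
    by (intro sum.cong) (auto simp: norm_mult norm_power)
  thus ?thesis by (simp add: sum.If_cases)
qed

text \<open>
  The sign of the permutation that reverses a word of length \<open>card S\<close>; a new largest index has to
  pass each of the others once.
\<close>

lemma reorder_sign_self:
  fixes S :: "'n::{finite,linorder} set"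
  shows "reorder_sign S S = (-1) ^ (card S * (card S - 1) div 2)"
proof -
  have "finite S" by simp
  thus ?thesis
  proof (induction S rule: finite_linorder_max_induct)
    case (insert b A)
    have b: "b \<notin> A" using insert by auto
    hence split: "insert b A = sym_diff {b} A" by auto
    have 1: "reorder_sign {b} A = (-1) ^ card A"
      using insert.hyps by (simp add: reorder_sign_def)
    have 2: "reorder_sign A {b} = 1"
      using insert.hyps by (auto simp: reorder_sign_def intro!: prod.neutral)
    have "reorder_sign (insert b A) (insert b A) = (-1) ^ card A * reorder_sign A A"
      unfolding split reorder_sign_left reorder_sign_right 1 2 by (simp add: reorder_sign_def)
    also have "\<dots> = (-1) ^ (card A + card A * (card A - 1) div 2)"
      by (simp add: insert.IH power_add)
    also have "card A + card A * (card A - 1) div 2 = Suc (card A) * (Suc (card A) - 1) div 2"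
      by (cases "card A") (simp_all add: algebra_simps)
    finally show ?case using insert b by simp
  qed simp
qed

text \<open>
  For \<open>q = 2 m\<close> reversing a product of \<open>q\<close> generators costs the sign \<open>(-1)\<^sup>m\<close>, since
  \<open>q (q - 1) / 2 = m (2 m - 1)\<close> has the parity of \<open>m\<close>. The prefactor \<open>\<i>\<^sup>m\<close> is there to compensate for
  it.
\<close>

lemma star_syk_element:
  assumes "even q"
  shows "star (syk_element q J) = syk_element q J"
proof -
  obtain m where m: "q = 2 * m" using assms by (elim evenE)
  have "reorder_sign S S = (-1) ^ m" if "card S = q" for S :: "'a set"
  proof -
    have "card S * (card S - 1) div 2 = m * (2 * m - 1)" using that m by simp
    hence "reorder_sign S S = (-1) ^ (m * (2 * m - 1))" by (simp only: reorder_sign_self)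
    thus ?thesis by (cases "m = 0") (auto simp: minus_one_power_iff)
  qed
  moreover have "(-1) ^ m * cnj (\<i> ^ m) = \<i> ^ m"
    by (simp flip: power_mult_distrib)
  ultimately show ?thesis
    by (intro clifford_eqI) (simp add: star_def coeff_syk_element m flip: mult.assoc)
qed

section \<open>Measurability of coefficients of exponentials\<close>

text \<open>
  Working with one coefficient at a time keeps all random variables complex-valued: the coefficients
  of powers are polynomials in those of \<open>x\<close>, and the exponential is a pointwise limit.
\<close>

lemma coeff_exp_measurable:
  fixes x :: "'a \<Rightarrow> 'n::{finite,linorder} clifford"
  assumes x: "\<And>S. (\<lambda>\<omega>. coeff (x \<omega>) S) \<in> borel_measurable M"
  shows "(\<lambda>\<omega>. coeff (exp (x \<omega>)) S) \<in> borel_measurable M"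
proof (rule borel_measurable_LIMSEQ_metric)
  have power: "(\<lambda>\<omega>. coeff (x \<omega> ^ k) S) \<in> borel_measurable M" for k S
  proof (induction k arbitrary: S)
    case (Suc k)
    show ?case unfolding power_Suc coeff_times
      by (intro borel_measurable_sum borel_measurable_times borel_measurable_const x Suc)
  qed simp
  show "(\<lambda>\<omega>. \<Sum>k<n. coeff (x \<omega> ^ k /\<^sub>R fact k) S) \<in> borel_measurable M" for n
    unfolding coeff_simps
    by (intro borel_measurable_sum borel_measurable_times borel_measurable_const power)
  show "(\<lambda>n. \<Sum>k<n. coeff (x \<omega> ^ k /\<^sub>R fact k) S) \<longlonglongrightarrow> coeff (exp (x \<omega>)) S" for \<omega>
    using bounded_linear.sums[OF bounded_linear_coeff exp_converges] by (simp add: sums_def)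
qed

lemma ln_ntrace_exp_times_exp_measurable:
  fixes x y :: "'a \<Rightarrow> 'n::{finite,linorder} clifford"
  assumes "\<And>S. (\<lambda>\<omega>. coeff (x \<omega>) S) \<in> borel_measurable M"
    and "\<And>S. (\<lambda>\<omega>. coeff (y \<omega>) S) \<in> borel_measurable M"
  shows "(\<lambda>\<omega>. ln (Re (ntrace (exp (x \<omega>) * exp (y \<omega>))))) \<in> borel_measurable M"
proof -
  note [measurable] = coeff_exp_measurable[OF assms(1)] coeff_exp_measurable[OF assms(2)]
  show ?thesis unfolding ntrace_times by measurable
qed

lemma coeff_syk_element_measurable:
  assumes "\<And>S. card S = q \<Longrightarrow> (\<lambda>\<omega>. J \<omega> S) \<in> borel_measurable M"
  shows "(\<lambda>\<omega>. coeff (syk_element q (J \<omega>)) S) \<in> borel_measurable M"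
  using assms by (cases "card S = q") (simp_all add: coeff_syk_element)

section \<open>Families of independent centred Gaussians\<close>

definition gaussian_family :: "'w measure \<Rightarrow> 'i set \<Rightarrow> ('i \<Rightarrow> real) \<Rightarrow> ('i \<Rightarrow> 'w \<Rightarrow> real) \<Rightarrow> bool" where
  "gaussian_family M I \<sigma> X \<longleftrightarrow> prob_space M \<and> finite I \<and> (\<forall>i\<in>I. \<sigma> i > 0) \<and>
    prob_space.indep_vars M (\<lambda>_. borel) X I \<and>
    (\<forall>i\<in>I. distributed M lborel (X i) (normal_density 0 (\<sigma> i)))"

lemma gaussian_family_measurable:
  assumes "gaussian_family M I \<sigma> X" "i \<in> I"
  shows "X i \<in> borel_measurable M"
  using assms distributed_measurable[of M lborel "X i"] by (auto simp: gaussian_family_def)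

lemma integrable_gaussian_family:
  assumes "gaussian_family M I \<sigma> X" "i \<in> I"
  shows "integrable M (X i)"
proof -
  have "integrable lborel (\<lambda>x. normal_density 0 (\<sigma> i) x * x)"
    using integrable_normal_moment[of "\<sigma> i" 0 1] assms by (auto simp: gaussian_family_def)
  thus ?thesis
    using assms distributed_integrable[of M lborel "X i" "normal_density 0 (\<sigma> i)" "\<lambda>x. x"]
    by (auto simp: gaussian_family_def)
qed

text \<open>
  Blocks of two elements give the weighted sum of two independent
  copies, and blocks of one element give scaling, sign changes and passage to a subfamily with a new
  index set.
\<close>

lemma gaussian_family_block_sums:
  assumes X: "gaussian_family M I \<sigma> X"
    and L: "finite L" "disjoint_family_on K L" "\<And>j. j \<in> L \<Longrightarrow> K j \<subseteq> I" "\<And>j. j \<in> L \<Longrightarrow> K j \<noteq> {}"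
    and w: "\<And>i. i \<in> I \<Longrightarrow> w i \<noteq> 0"
  shows "gaussian_family M L (\<lambda>j. sqrt (\<Sum>i\<in>K j. (w i * \<sigma> i)\<^sup>2)) (\<lambda>j \<omega>. \<Sum>i\<in>K j. w i * X i \<omega>)"
proof -
  interpret prob_space M using X by (simp add: gaussian_family_def)
  have fin: "finite (K j)" if "j \<in> L" for j
    using X L(3)[OF that] by (auto simp: gaussian_family_def intro: finite_subset)
  have pos: "\<sigma> i > 0" if "i \<in> I" for i using X that by (simp add: gaussian_family_def)
  have ind: "indep_vars (\<lambda>_. borel) X I" using X by (simp add: gaussian_family_def)
  have "indep_vars (\<lambda>_. borel) (\<lambda>j \<omega>. \<Sum>i\<in>K j. w i * restrict (\<lambda>i. X i \<omega>) (K j) i) L"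
    by (rule indep_vars_compose2[OF indep_vars_restrict[OF ind L(3) L(2)],
          where Y = "\<lambda>j f. \<Sum>i\<in>K j. w i * f i"]) auto
  moreover have "distributed M lborel (\<lambda>\<omega>. \<Sum>i\<in>K j. w i * X i \<omega>)
      (normal_density 0 (sqrt (\<Sum>i\<in>K j. (w i * \<sigma> i)\<^sup>2)))" if j: "j \<in> L" for j
  proof -
    have "indep_vars (\<lambda>_. borel) (\<lambda>i \<omega>. w i * X i \<omega>) (K j)"
      by (rule indep_vars_compose2[OF indep_vars_subset[OF ind L(3)[OF j]],
          where Y = "\<lambda>i x. w i * x"]) auto
    moreover have "distributed M lborel (\<lambda>\<omega>. w i * X i \<omega>) (normal_density 0 (\<bar>w i\<bar> * \<sigma> i))"
      if "i \<in> K j" for i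
    proof -
      have i: "i \<in> I" using that L(3)[OF j] by auto
      thus ?thesis
        using normal_density_affine[of "X i" 0 "\<sigma> i" "w i" 0] X pos w
        by (auto simp: gaussian_family_def)
    qed
    ultimately have "distributed M lborel (\<lambda>\<omega>. \<Sum>i\<in>K j. w i * X i \<omega>)
      (normal_density (\<Sum>i\<in>K j. 0) (sqrt (\<Sum>i\<in>K j. (\<bar>w i\<bar> * \<sigma> i)\<^sup>2)))"
      using fin[OF j] L(3,4)[OF j] pos w by (intro sum_indep_normal) (auto simp: subset_eq)
    thus ?thesis by (simp add: power_mult_distrib)
  qed
  moreover have "(\<Sum>i\<in>K j. (w i * \<sigma> i)\<^sup>2) > 0" if j: "j \<in> L" for j
  proof (rule sum_pos)
    fix i assume "i \<in> K j"
    hence "i \<in> I" using L(3)[OF j] by auto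
    thus "(w i * \<sigma> i)\<^sup>2 > 0" using pos[of i] w[of i] by simp
  qed (use fin[OF j] L(4)[OF j] in auto)
  ultimately show ?thesis
    using L(1) by (simp add: gaussian_family_def prob_space_axioms cong: sum.cong)
qed

text \<open>
  The joint law of independent variables is the product of their laws. Hence the expectation of a
  function of the family depends on the standard deviations only.
\<close>

lemma integral_gaussian_family:
  fixes f :: "('i \<Rightarrow> real) \<Rightarrow> real"
  assumes X: "gaussian_family M I \<sigma> X"
    and f: "f \<in> borel_measurable (PiM I (\<lambda>_. borel))"
  shows "(\<integral>\<omega>. f (\<lambda>i\<in>I. X i \<omega>) \<partial>M) =
    integral\<^sup>L (PiM I (\<lambda>i. density lborel (normal_density 0 (\<sigma> i)))) f"
proof -
  interpret prob_space M using X by (simp add: gaussian_family_def)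
  let ?N = "\<lambda>i. density lborel (normal_density 0 (\<sigma> i))"
  have rv: "X i \<in> borel_measurable M" if "i \<in> I" for i
    by (rule gaussian_family_measurable[OF X that])
  show ?thesis
  proof (cases "I = {}")
    case True
    thus ?thesis by (simp add: PiM_empty prob_space restrict_def lebesgue_integral_count_space_finite)
  next
    case False
    have "distr M (PiM I (\<lambda>_. borel)) (\<lambda>\<omega>. \<lambda>i\<in>I. X i \<omega>) = PiM I (\<lambda>i. distr M borel (X i))"
      using X indep_vars_iff_distr_eq_PiM'[OF False, where M' = "\<lambda>_. borel" and X = X] rv
      by (simp add: gaussian_family_def)
    also have "\<dots> = PiM I ?N"
    proof (rule PiM_cong)
      fix i assume "i \<in> I"
      hence "distr M lborel (X i) = ?N i"
        using X by (simp add: gaussian_family_def distributed_distr_eq_density)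
      thus "distr M borel (X i) = ?N i"
        by (metis distr_cong sets_lborel)
    qed simp
    finally have "integral\<^sup>L (PiM I ?N) f =
        integral\<^sup>L (distr M (PiM I (\<lambda>_. borel)) (\<lambda>\<omega>. \<lambda>i\<in>I. X i \<omega>)) f" by simp
    also have "\<dots> = (\<integral>\<omega>. f (\<lambda>i\<in>I. X i \<omega>) \<partial>M)"
      using rv by (intro integral_distr f measurable_restrict) auto
    finally show ?thesis ..
  qed
qed

lemma gaussian_family_coordinates:
  assumes "finite I" "\<And>i. i \<in> I \<Longrightarrow> \<sigma> i > 0"
  shows "gaussian_family (PiM I (\<lambda>i. density lborel (normal_density 0 (\<sigma> i)))) I \<sigma> (\<lambda>i \<omega>. \<omega> i)"
proof -
  let ?N = "\<lambda>i. density lborel (normal_density 0 (\<sigma> i))"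
  let ?Q = "PiM I ?N"
  have N: "prob_space (?N i)" if "i \<in> I" for i
    using assms(2)[OF that] by (rule prob_space_normal_density)
  interpret prob_space ?Q by (rule prob_space_PiM[OF N])
  have sets: "sets ?Q = sets (PiM I (\<lambda>_. borel))" by (intro sets_PiM_cong) auto
  have meas: "(\<lambda>\<omega>. \<omega> i) \<in> borel_measurable ?Q" if "i \<in> I" for i
    using measurable_component_singleton[OF that, of "\<lambda>_. borel"] sets
    by (simp cong: measurable_cong_sets)
  have distr: "distr ?Q borel (\<lambda>\<omega>. \<omega> i) = ?N i" if "i \<in> I" for i
    using distr_PiM_component[OF N that] by (simp cong: distr_cong)
  have "distr ?Q (PiM I (\<lambda>_. borel)) (\<lambda>\<omega>. \<lambda>i\<in>I. \<omega> i) = distr ?Q ?Q (\<lambda>\<omega>. \<omega>)"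
    using sets by (intro distr_cong) (auto simp: space_PiM)
  also have "\<dots> = PiM I (\<lambda>i. distr ?Q borel (\<lambda>\<omega>. \<omega> i))"
    by (simp add: distr cong: PiM_cong)
  finally have distr_eq: "distr ?Q (PiM I (\<lambda>_. borel)) (\<lambda>\<omega>. \<lambda>i\<in>I. \<omega> i) =
      PiM I (\<lambda>i. distr ?Q borel (\<lambda>\<omega>. \<omega> i))" .
  have "indep_vars (\<lambda>_. borel) (\<lambda>i \<omega>. \<omega> i) {}"
    by (simp add: indep_vars_def indep_sets_def)
  with distr_eq have "indep_vars (\<lambda>_. borel) (\<lambda>i \<omega>. \<omega> i) I"
    using meas indep_vars_iff_distr_eq_PiM'[where I = I and M' = "\<lambda>_. borel" and X = "\<lambda>i \<omega>. \<omega> i"]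
    by (cases "I = {}") auto
  moreover have "distributed ?Q lborel (\<lambda>\<omega>. \<omega> i) (normal_density 0 (\<sigma> i))" if "i \<in> I" for i
    using distr[OF that] meas[OF that] by (auto simp: distributed_def cong: distr_cong)
  ultimately show ?thesis
    using assms by (simp add: gaussian_family_def prob_space_axioms)
qed

lemma integral_gaussian_family_eq:
  fixes f :: "('i \<Rightarrow> real) \<Rightarrow> real"
  assumes X: "gaussian_family M I \<sigma> X" and Y: "gaussian_family N I \<sigma> Y"
    and f: "f \<in> borel_measurable (PiM I (\<lambda>_. borel))"
    and only_I: "\<And>x. f (restrict x I) = f x"
  shows "(\<integral>\<omega>. f (\<lambda>i. X i \<omega>) \<partial>M) = (\<integral>\<omega>. f (\<lambda>i. Y i \<omega>) \<partial>N)"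
  using integral_gaussian_family[OF X f] integral_gaussian_family[OF Y f] by (simp add: only_I)

section \<open>Subadditivity of the free energy\<close>

definition log_partition :: "nat \<Rightarrow> ('n::{finite,linorder} set \<Rightarrow> real) \<Rightarrow> real" where
  "log_partition q J = ln (Re (ntrace (exp (syk_element q J))))"

lemma syk_free_energy_eq:
  "syk_free_energy M J q \<beta> = (\<integral>\<omega>. log_partition q (\<lambda>S. \<beta> * J S \<omega>) \<partial>M)"
  by (simp add: syk_free_energy_def syk_hamiltonian_def op_trace_exp_left_mult log_partition_def
      syk_element_scaleR mult.commute[of "2 ^ CARD('a)"])

lemma log_partition_measurable:
  "log_partition q \<in> borel_measurable (PiM {S :: 'n::{finite,linorder} set. card S = q} (\<lambda>_. borel))"
proof -
  have "(\<lambda>J :: 'n set \<Rightarrow> real. ln (Re (ntrace (exp (syk_element q J) * exp 0)))) \<in>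
      borel_measurable (PiM {S. card S = q} (\<lambda>_. borel))"
    by (intro ln_ntrace_exp_times_exp_measurable coeff_syk_element_measurable) auto
  thus ?thesis by (simp add: log_partition_def[abs_def])
qed

text \<open>
  The free energy depends only on the law of the couplings, so it can be computed from any
  independent Gaussians of the right variance, on any probability space.
\<close>

lemma integral_log_partition:
  fixes J :: "'n::{finite,linorder} set \<Rightarrow> 'w \<Rightarrow> real" and Y :: "'n set \<Rightarrow> 'v \<Rightarrow> real"
  assumes J: "gaussian_family M {S. card S = q} (\<lambda>_. \<sigma>) J"
    and Y: "gaussian_family N {S. card S = q} (\<lambda>_. \<beta> * \<sigma>) Y"
    and "\<beta> > 0" and "\<sigma> > 0"
  shows "(\<integral>\<omega>. log_partition q (\<lambda>S. Y S \<omega>) \<partial>N) = syk_free_energy M J q \<beta>"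
proof -
  have "gaussian_family M {S. card S = q} (\<lambda>_. \<beta> * \<sigma>) (\<lambda>S \<omega>. \<beta> * J S \<omega>)"
    using gaussian_family_block_sums[OF J, where L = "{S. card S = q}" and K = "\<lambda>S. {S}"
        and w = "\<lambda>_. \<beta>"] assms(3,4) by (simp add: disjoint_family_on_def)
  moreover have "log_partition q (restrict x {S. card S = q}) = log_partition q x"
    for x :: "'n set \<Rightarrow> real"
    by (simp add: log_partition_def cong: syk_element_cong)
  ultimately have "(\<integral>\<omega>. log_partition q (\<lambda>S. Y S \<omega>) \<partial>N) =
      (\<integral>\<omega>. log_partition q (\<lambda>S. \<beta> * J S \<omega>) \<partial>M)"
    by (intro integral_gaussian_family_eq[OF Y] log_partition_measurable)
  thus ?thesis by (simp only: syk_free_energy_eq)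
qed

lemma syk_free_energy_zero: "syk_free_energy M (J :: 'a::{finite,linorder} set \<Rightarrow> _) q 0 = 0"
proof -
  have "syk_element q (\<lambda>S. 0) = (0 :: 'a clifford)" by (rule clifford_eqI) (simp add: coeff_syk_element)
  thus ?thesis by (simp add: syk_free_energy_eq log_partition_def ntrace_def coeff_one)
qed

text \<open>
  The two independent copies of the couplings are realized together as one family of independent
  Gaussians indexed by \<open>{S. card S = q} \<times> bool\<close>, the boolean telling the copies apart.
\<close>

lemma syk_free_energy_subadditive:
  fixes J :: "'n::{finite,linorder} set \<Rightarrow> 'w \<Rightarrow> real"
  assumes J: "gaussian_family M {S. card S = q} (\<lambda>_. \<sigma>) J"
    and "even q" and \<beta>: "\<beta>1 > 0" "\<beta>2 > 0" and \<sigma>: "\<sigma> > 0"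
  shows "syk_free_energy M J q (sqrt (\<beta>1\<^sup>2 + \<beta>2\<^sup>2)) \<le>
    syk_free_energy M J q \<beta>1 + syk_free_energy M J q \<beta>2"
proof -
  let ?I = "{S :: 'n set. card S = q}"
  define K where "K = ?I \<times> (UNIV :: bool set)"
  define Q where "Q = PiM K (\<lambda>_. density lborel (normal_density 0 \<sigma>))"
  have G: "gaussian_family Q K (\<lambda>_. \<sigma>) (\<lambda>p \<omega>. \<omega> p)"
    unfolding Q_def using \<sigma> by (intro gaussian_family_coordinates) (auto simp: K_def)
  interpret prob_space Q using G by (simp add: gaussian_family_def)

  define A :: "('n set \<times> bool \<Rightarrow> real) \<Rightarrow> 'n clifford"
    where "A \<omega> = syk_element q (\<lambda>S. \<beta>1 * \<omega> (S, True))" for \<omega>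
  define B :: "('n set \<times> bool \<Rightarrow> real) \<Rightarrow> 'n clifford"
    where "B \<omega> = syk_element q (\<lambda>S. \<beta>2 * \<omega> (S, False))" for \<omega>
  have star: "star (A \<omega>) = A \<omega>" "star (B \<omega>) = B \<omega>" for \<omega>
    using \<open>even q\<close> by (simp_all add: A_def B_def star_syk_element)

  have "gaussian_family Q ?I (\<lambda>_. \<beta>1 * \<sigma>) (\<lambda>S \<omega>. \<beta>1 * \<omega> (S, True))"
    using gaussian_family_block_sums[OF G, where L = ?I and K = "\<lambda>S. {(S, True)}"
        and w = "\<lambda>_. \<beta>1"] \<beta> \<sigma> by (simp add: disjoint_family_on_def K_def)
  from integral_log_partition[OF J this \<beta>(1) \<sigma>]
  have F1: "syk_free_energy M J q \<beta>1 = (\<integral>\<omega>. ln (Re (ntrace (exp (A \<omega>)))) \<partial>Q)"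
    by (simp add: log_partition_def A_def)
  have "gaussian_family Q ?I (\<lambda>_. \<beta>2 * \<sigma>) (\<lambda>S \<omega>. \<beta>2 * \<omega> (S, False))"
    using gaussian_family_block_sums[OF G, where L = ?I and K = "\<lambda>S. {(S, False)}"
        and w = "\<lambda>_. \<beta>2"] \<beta> \<sigma> by (simp add: disjoint_family_on_def K_def)
  from integral_log_partition[OF J this \<beta>(2) \<sigma>]
  have F2: "syk_free_energy M J q \<beta>2 = (\<integral>\<omega>. ln (Re (ntrace (exp (B \<omega>)))) \<partial>Q)"
    by (simp add: log_partition_def B_def)
  have sd: "sqrt ((\<beta>1 * \<sigma>)\<^sup>2 + (\<beta>2 * \<sigma>)\<^sup>2) = sqrt (\<beta>1\<^sup>2 + \<beta>2\<^sup>2) * \<sigma>"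
    using \<sigma> by (simp add: power_mult_distrib real_sqrt_mult flip: distrib_right)
  have "gaussian_family Q ?I (\<lambda>_. sqrt (\<beta>1\<^sup>2 + \<beta>2\<^sup>2) * \<sigma>)
      (\<lambda>S \<omega>. \<beta>1 * \<omega> (S, True) + \<beta>2 * \<omega> (S, False))"
    using gaussian_family_block_sums[OF G, where L = ?I and K = "\<lambda>S. {(S, True), (S, False)}"
        and w = "\<lambda>p. if snd p then \<beta>1 else \<beta>2"] \<beta> \<sigma>
    by (simp add: disjoint_family_on_def K_def sd)
  from integral_log_partition[OF J this _ \<sigma>]
  have F: "syk_free_energy M J q (sqrt (\<beta>1\<^sup>2 + \<beta>2\<^sup>2)) =
      (\<integral>\<omega>. ln (Re (ntrace (exp (A \<omega> + B \<omega>)))) \<partial>Q)"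
    using \<beta> by (simp add: log_partition_def A_def B_def syk_element_add add_pos_pos)

  define \<Phi> :: "'n set \<Rightarrow> ('n set \<times> bool \<Rightarrow> real) \<Rightarrow> real"
    where "\<Phi> T \<omega> = ln (Re (ntrace (exp (A \<omega>) * exp (flip T (B \<omega>)))))" for T \<omega>
  have coeff_meas: "(\<lambda>\<omega>. coeff (A \<omega>) S) \<in> borel_measurable N"
      "(\<lambda>\<omega>. coeff (B \<omega>) S) \<in> borel_measurable N"
    if "\<And>p. p \<in> K \<Longrightarrow> (\<lambda>\<omega>. \<omega> p) \<in> borel_measurable N"
    for S and N :: "('n set \<times> bool \<Rightarrow> real) measure"
    unfolding A_def B_def using that
    by (intro coeff_syk_element_measurable borel_measurable_times borel_measurable_const;
        simp add: K_def)+
  note coeff_Q = coeff_meas[OF gaussian_family_measurable[OF G]]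

  have int_norm: "integrable Q (\<lambda>\<omega>. norm (A \<omega>))" "integrable Q (\<lambda>\<omega>. norm (B \<omega>))"
    unfolding A_def B_def norm_syk_element
    by (intro Bochner_Integration.integrable_sum integrable_abs integrable_mult_right
        integrable_gaussian_family[OF G]; simp add: K_def)+
  \<comment> \<open>One domination argument for \<open>A + B\<close>, \<open>A\<close> and \<open>B\<close> alone, paired with \<open>0\<close>, and for the
    products with \<open>flip T B\<close>.\<close>
  have int: "integrable Q (\<lambda>\<omega>. ln (Re (ntrace (exp (x \<omega>) * exp (y \<omega>)))))"
    if "\<And>S. (\<lambda>\<omega>. coeff (x \<omega>) S) \<in> borel_measurable Q"
      "\<And>S. (\<lambda>\<omega>. coeff (y \<omega>) S) \<in> borel_measurable Q"
      "\<And>\<omega>. star (x \<omega>) = x \<omega>" "\<And>\<omega>. star (y \<omega>) = y \<omega>"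
      "\<And>\<omega>. norm (x \<omega>) + norm (y \<omega>) \<le> norm (A \<omega>) + norm (B \<omega>)" for x y :: "_ \<Rightarrow> 'n clifford"
  proof (rule Bochner_Integration.integrable_bound)
    show "integrable Q (\<lambda>\<omega>. norm (A \<omega>) + norm (B \<omega>) + CARD('n) * ln 2)"
      by (intro Bochner_Integration.integrable_add int_norm integrable_const)
    show "(\<lambda>\<omega>. ln (Re (ntrace (exp (x \<omega>) * exp (y \<omega>))))) \<in> borel_measurable Q"
      by (rule ln_ntrace_exp_times_exp_measurable[OF that(1,2)])
    show "AE \<omega> in Q. norm (ln (Re (ntrace (exp (x \<omega>) * exp (y \<omega>))))) \<le>
        norm (norm (A \<omega>) + norm (B \<omega>) + CARD('n) * ln 2)"
    proof (rule AE_I2)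
      fix \<omega>
      show "norm (ln (Re (ntrace (exp (x \<omega>) * exp (y \<omega>))))) \<le>
          norm (norm (A \<omega>) + norm (B \<omega>) + CARD('n) * ln 2)"
        using ntrace_exp_times_exp(3)[OF that(3)[of \<omega>] that(4)[of \<omega>]] that(5)[of \<omega>] by simp
    qed
  qed
  have int_sum: "integrable Q (\<lambda>\<omega>. ln (Re (ntrace (exp (A \<omega> + B \<omega>)))))"
    using int[of "\<lambda>\<omega>. A \<omega> + B \<omega>" "\<lambda>_. 0"] coeff_Q
    by (simp add: star_plus star star_zero norm_triangle_ineq)
  have int_A: "integrable Q (\<lambda>\<omega>. ln (Re (ntrace (exp (A \<omega>)))))"
    using int[of A "\<lambda>_. 0"] coeff_Q by (simp add: star star_zero)
  have int_B: "integrable Q (\<lambda>\<omega>. ln (Re (ntrace (exp (B \<omega>)))))"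
    using int[of "\<lambda>_. 0" B] coeff_Q by (simp add: star star_zero)
  have int_\<Phi>: "integrable Q (\<Phi> T)" for T
    unfolding \<Phi>_def by (rule int) (use coeff_Q in \<open>simp_all add: star star_flip\<close>)

  \<comment> \<open>Flipping \<open>B\<close> reverses some of the Gaussians of the second copy, which keeps their joint law.\<close>
  have \<Phi>_eq: "integral\<^sup>L Q (\<Phi> T) = integral\<^sup>L Q (\<Phi> {})" for T
  proof -
    let ?w = "\<lambda>p. if snd p then 1 else flip_sign T (fst p)"
    have sq: "(?w p * \<sigma>)\<^sup>2 = \<sigma>\<^sup>2" for p
      by (simp add: power_mult_distrib flip: power2_abs[of "flip_sign T _"])
    have "flip_sign T S \<noteq> 0" for S using abs_flip_sign[of T S] by force
    hence "gaussian_family Q K (\<lambda>_. \<sigma>) (\<lambda>p \<omega>. ?w p * \<omega> p)"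
      using gaussian_family_block_sums[OF G, where L = K and K = "\<lambda>p. {p}" and w = ?w] \<sigma>
      by (simp add: disjoint_family_on_def K_def sq)
    moreover have "\<Phi> {} \<in> borel_measurable (PiM K (\<lambda>_. borel))"
      unfolding \<Phi>_def flip_empty
      by (intro ln_ntrace_exp_times_exp_measurable coeff_meas) auto
    moreover have "\<Phi> {} (restrict \<omega> K) = \<Phi> {} \<omega>" for \<omega>
      by (simp add: \<Phi>_def A_def B_def K_def cong: syk_element_cong)
    ultimately have "(\<integral>\<omega>. \<Phi> {} (\<lambda>p. ?w p * \<omega> p) \<partial>Q) = (\<integral>\<omega>. \<Phi> {} (\<lambda>p. \<omega> p) \<partial>Q)"
      by (intro integral_gaussian_family_eq[OF _ G])
    moreover have "\<Phi> {} (\<lambda>p. ?w p * \<omega> p) = \<Phi> T \<omega>" for \<omega>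
      by (simp add: \<Phi>_def A_def B_def flip_syk_element mult.left_commute)
    ultimately show ?thesis by simp
  qed

  \<comment> \<open>Golden--Thompson, pointwise in \<open>\<omega>\<close>.\<close>
  have "syk_free_energy M J q (sqrt (\<beta>1\<^sup>2 + \<beta>2\<^sup>2)) \<le> integral\<^sup>L Q (\<Phi> {})"
    unfolding F
  proof (rule integral_mono[OF int_sum int_\<Phi>])
    fix \<omega>
    have AB: "star (A \<omega> + B \<omega>) = A \<omega> + B \<omega>" by (simp add: star_plus star)
    have "norm (ntrace x) = Re (ntrace x)" if "ntrace x = of_real (Re (ntrace x))" "Re (ntrace x) > 0"
      for x :: "'n clifford"
      using that by (metis abs_of_pos norm_of_real)
    hence "Re (ntrace (exp (A \<omega> + B \<omega>))) \<le> Re (ntrace (exp (A \<omega>) * exp (B \<omega>)))"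
      using golden_thompson[OF star(1)[of \<omega>] star(2)[of \<omega>]] ntrace_exp_times_exp(1,2)[OF AB star_zero]
        ntrace_exp_times_exp(1,2)[OF star(1)[of \<omega>] star(2)[of \<omega>]] by simp
    thus "ln (Re (ntrace (exp (A \<omega> + B \<omega>)))) \<le> \<Phi> {} \<omega>"
      using ntrace_exp_times_exp(2)[OF AB star_zero] by (simp add: \<Phi>_def)
  qed
  moreover have "2 ^ CARD('n) * integral\<^sup>L Q (\<Phi> {}) \<le>
      2 ^ CARD('n) * (syk_free_energy M J q \<beta>1 + syk_free_energy M J q \<beta>2)"
  proof -
    have "2 ^ CARD('n) * integral\<^sup>L Q (\<Phi> {}) = (\<Sum>T\<in>(UNIV :: 'n set set). integral\<^sup>L Q (\<Phi> T))"
      by (subst \<Phi>_eq) (simp add: card_UNIV_set)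
    also have "\<dots> = (\<integral>\<omega>. (\<Sum>T\<in>UNIV. \<Phi> T \<omega>) \<partial>Q)"
      by (simp add: Bochner_Integration.integral_sum int_\<Phi>)
    also have "\<dots> \<le> (\<integral>\<omega>. 2 ^ CARD('n) *
        (ln (Re (ntrace (exp (A \<omega>)))) + ln (Re (ntrace (exp (B \<omega>))))) \<partial>Q)"
    proof (rule integral_mono)
      show "integrable Q (\<lambda>\<omega>. \<Sum>T\<in>UNIV. \<Phi> T \<omega>)"
        by (intro Bochner_Integration.integrable_sum int_\<Phi>)
      show "integrable Q (\<lambda>\<omega>. 2 ^ CARD('n) *
          (ln (Re (ntrace (exp (A \<omega>)))) + ln (Re (ntrace (exp (B \<omega>))))))"
        by (intro integrable_mult_right Bochner_Integration.integrable_add int_A int_B)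
    qed (simp add: \<Phi>_def sum_ln_ntrace_flip_le star)
    also have "\<dots> = 2 ^ CARD('n) * (syk_free_energy M J q \<beta>1 + syk_free_energy M J q \<beta>2)"
      by (simp add: F1 F2 int_A int_B)
    finally show ?thesis .
  qed
  ultimately show ?thesis by simp
qed

theorem corollary3p3:
  fixes M :: "'w measure"
    and J :: "'n::{finite,linorder} set \<Rightarrow> 'w \<Rightarrow> real"
    and q :: nat
    and \<sigma> \<beta>1 \<beta>2 :: real
  assumes "q \<ge> 1" and "even q"
    and "\<beta>1 \<ge> 0" and "\<beta>2 \<ge> 0"
    and "\<sigma> > 0"
    and "prob_space M"
    and "prob_space.indep_vars M (\<lambda>_. borel) J {S. card S = q}"
    and "\<And>S. card S = q \<Longrightarrow> distributed M lborel (J S) (normal_density 0 \<sigma>)"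
  shows "syk_free_energy M J q (sqrt (\<beta>1\<^sup>2 + \<beta>2\<^sup>2))
    \<le> syk_free_energy M J q \<beta>1 + syk_free_energy M J q \<beta>2"
proof -
  have J: "gaussian_family M {S. card S = q} (\<lambda>_. \<sigma>) J"
    using assms(5-8) by (simp add: gaussian_family_def)
  \<comment> \<open>At inverse temperature \<open>0\<close> the scaled couplings are constant and have no Gaussian density, so
    these cases are separate.\<close>
  consider "\<beta>1 = 0" | "\<beta>2 = 0" | "\<beta>1 > 0" "\<beta>2 > 0" using assms(3,4) by linarith
  thus ?thesis
  proof cases
    case 3
    thus ?thesis by (rule syk_free_energy_subadditive[OF J assms(2) _ _ assms(5)])
  qed (use assms(3,4) in \<open>simp_all add: syk_free_energy_zero\<close>)
qed

end
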